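(* Let $\mathcal C$ be a triangulated category, let $(\mathcal D,\mathcal T)$ be a right filterable pair of $t$-structures on $\mathcal C$, and let $m\in\mathbb N$. Then $$\mathcal D^{\le -m}\subseteq\mathcal T^{\le 0}\subseteq\mathcal D^{\le 0}\qquad(\text{equivalently }\ \mathcal D^{\ge 0}\subseteq\mathcal T^{\ge 0}\subseteq\mathcal D^{\ge -m})$$ holds if and only if $\mathcal T$ is obtained from $\mathcal D$ by an iterated HRS procedure of length $m$.
   Context: Full subcategories are closed under isomorphisms and additive. For a $t$-structure $\mathcal D=(\mathcal D^{\le 0},\mathcal D^{\ge 0})$ on a triangulated category $\mathcal C$ put $\mathcal D^{\le i}:=\mathcal D^{\le 0}[-i]$, $\mathcal D^{\ge i}:=\mathcal D^{\ge 0}[-i]$; $\mathcal D^{\le 0}$ is the aisle and $\mathcal D^{\ge 0}$ the co-aisle; $\mathcal H_{\mathcal D}=\mathcal D^{\le 0}\cap\mathcal D^{\ge 0}$ is the heart and $H^i_{\mathcal D}:\mathcal C\to\mathcal H_{\mathcal D}$ are the cohomological functors. All $t$-structures considered are non-degenerate: $\bigcap_i\mathcal D^{\le i}=0=\bigcap_i\mathcal D^{\ge i}$. The pair $(\mathcal D,\mathcal T)$ is right filterable if for every $i\in\mathbb Z$ the intersection $\mathcal D^{\ge i}\cap\mathcal T^{\ge 0}$ is the co-aisle of a $t$-structure on $\mathcal C$. Tilting: given a $t$-structure $\mathcal E$ and a torsion pair $(\mathcal X,\mathcal Y)$ in the abelian category $\mathcal H_{\mathcal E}$, the $t$-structure obtained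 by tilting $\mathcal E$ with respect to $(\mathcal X,\mathcal Y)$ has aisle $\{C : H^0_{\mathcal E}(C)\in\mathcal X,\ H^i_{\mathcal E}(C)=0\ \forall i>0\}$ and co-aisle $\{C : H^{-1}_{\mathcal E}(C)\in\mathcal Y,\ H^i_{\mathcal E}(C)=0\ \forall i<-1\}$. $\mathcal T$ is obtained from $\mathcal D$ by an iterated HRS procedure of length $m$ if there are $t$-structures $\mathcal E_0=\mathcal D,\mathcal E_1,\dots,\mathcal E_m=\mathcal T$ on $\mathcal C$ such that for $i=0,\dots,m-1$ the $t$-structure $\mathcal E_{i+1}$ is obtained by tilting $\mathcal E_i$ with respect to some torsion pair (possibly trivial) in $\mathcal H_{\mathcal E_i}$. *)

theory Defs
  imports "HOL-Algebra.Group"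
begin

section \<open>Additive categories\<close>

record ('o, 'a) category_data =
  Obj :: "'o set"
  Arr :: "'a set"
  Dom :: "'a \<Rightarrow> 'o"
  Cod :: "'a \<Rightarrow> 'o"
  Idn :: "'o \<Rightarrow> 'a"
  Cmp :: "'a \<Rightarrow> 'a \<Rightarrow> 'a"  (infixl "\<cdot>\<index>" 70)

definition Hom :: "('o, 'a, 'x) category_data_scheme \<Rightarrow> 'o \<Rightarrow> 'o \<Rightarrow> 'a set" where
  "Hom C X Y = {f \<in> Arr C. Dom C f = X \<and> Cod C f = Y}"

locale category =
  fixes C :: "('o, 'a, 'x) category_data_scheme" (structure)
  assumes Dom_closed: "f \<in> Arr C \<Longrightarrow> Dom C f \<in> Obj C"
    and Cod_closed: "f \<in> Arr C \<Longrightarrow> Cod C f \<in> Obj C"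
    and Idn_in_Hom: "X \<in> Obj C \<Longrightarrow> Idn C X \<in> Hom C X X"
    and Cmp_in_Hom: "\<lbrakk>g \<in> Hom C Y Z; f \<in> Hom C X Y\<rbrakk> \<Longrightarrow> g \<cdot> f \<in> Hom C X Z"
    and Cmp_Idn_left: "f \<in> Hom C X Y \<Longrightarrow> Idn C Y \<cdot> f = f"
    and Cmp_Idn_right: "f \<in> Hom C X Y \<Longrightarrow> f \<cdot> Idn C X = f"
    and Cmp_assoc: "\<lbrakk>h \<in> Hom C Z W; g \<in> Hom C Y Z; f \<in> Hom C X Y\<rbrakk>
      \<Longrightarrow> (h \<cdot> g) \<cdot> f = h \<cdot> (g \<cdot> f)"

definition is_iso :: "('o, 'a, 'x) category_data_scheme \<Rightarrow> 'a \<Rightarrow> bool" where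
  "is_iso C f \<longleftrightarrow> f \<in> Arr C \<and>
     (\<exists>g \<in> Hom C (Cod C f) (Dom C f).
        Cmp C g f = Idn C (Dom C f) \<and> Cmp C f g = Idn C (Cod C f))"

definition isomorphic :: "('o, 'a, 'x) category_data_scheme \<Rightarrow> 'o \<Rightarrow> 'o \<Rightarrow> bool" where
  "isomorphic C X Y \<longleftrightarrow> (\<exists>f \<in> Hom C X Y. is_iso C f)"

definition zero_objects :: "('o, 'a, 'x) category_data_scheme \<Rightarrow> 'o set" where
  "zero_objects C = {Z \<in> Obj C. \<forall>X \<in> Obj C. (\<exists>!f. f \<in> Hom C X Z) \<and> (\<exists>!f. f \<in> Hom C Z X)}"

definition full_subcat ::
    "('o, 'a, 'x) category_data_scheme \<Rightarrow> 'o set \<Rightarrow> ('o, 'a, 'x) category_data_scheme" where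
  "full_subcat C S = C\<lparr>Obj := S, Arr := {f \<in> Arr C. Dom C f \<in> S \<and> Cod C f \<in> S}\<rparr>"

record ('o, 'a) preadditive_data = "('o, 'a) category_data" +
  Add :: "'a \<Rightarrow> 'a \<Rightarrow> 'a"  (infixl "\<oplus>\<index>" 65)
  Zro :: "'o \<Rightarrow> 'o \<Rightarrow> 'a"

text \<open>The group of morphisms from \<open>X\<close> to \<open>Y\<close>; it is an additive group, although
  the theory of groups writes its operation multiplicatively.\<close>

definition Hom_group :: "('o, 'a, 'x) preadditive_data_scheme \<Rightarrow> 'o \<Rightarrow> 'o \<Rightarrow> 'a monoid" where
  "Hom_group C X Y = \<lparr>carrier = Hom C X Y, mult = Add C, one = Zro C X Y\<rparr>"

definition Neg :: "('o, 'a, 'x) preadditive_data_scheme \<Rightarrow> 'a \<Rightarrow> 'a" where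
  "Neg C f = inv\<^bsub>Hom_group C (Dom C f) (Cod C f)\<^esub> f"

locale preadditive_category = category C
  for C :: "('o, 'a, 'x) preadditive_data_scheme" (structure) +
  assumes Hom_comm_group: "\<lbrakk>X \<in> Obj C; Y \<in> Obj C\<rbrakk> \<Longrightarrow> comm_group (Hom_group C X Y)"
    and Cmp_Add_left: "\<lbrakk>g \<in> Hom C Y Z; g' \<in> Hom C Y Z; f \<in> Hom C X Y\<rbrakk>
      \<Longrightarrow> (g \<oplus> g') \<cdot> f = (g \<cdot> f) \<oplus> (g' \<cdot> f)"
    and Cmp_Add_right: "\<lbrakk>g \<in> Hom C Y Z; f \<in> Hom C X Y; f' \<in> Hom C X Y\<rbrakk>
      \<Longrightarrow> g \<cdot> (f \<oplus> f') = (g \<cdot> f) \<oplus> (g \<cdot> f')"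

definition is_biproduct ::
    "('o, 'a, 'x) preadditive_data_scheme \<Rightarrow> 'o \<Rightarrow> 'o \<Rightarrow> 'o \<Rightarrow> bool" where
  "is_biproduct C X Y P \<longleftrightarrow> P \<in> Obj C \<and>
     (\<exists>i \<in> Hom C X P. \<exists>j \<in> Hom C Y P. \<exists>p \<in> Hom C P X. \<exists>q \<in> Hom C P Y.
        Cmp C p i = Idn C X \<and> Cmp C q j = Idn C Y \<and>
        Cmp C q i = Zro C X Y \<and> Cmp C p j = Zro C Y X \<and>
        Add C (Cmp C i p) (Cmp C j q) = Idn C P)"

locale additive_category = preadditive_category +
  assumes zero_object_exists: "zero_objects C \<noteq> {}"
    and biproduct_exists: "\<lbrakk>X \<in> Obj C; Y \<in> Obj C\<rbrakk> \<Longrightarrow> \<exists>P. is_biproduct C X Y P"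

text \<open>A full subcategory is identified with its set of objects. Full subcategories are always
  understood to be closed under isomorphisms and additive.\<close>

definition full_subcategory :: "('o, 'a, 'x) preadditive_data_scheme \<Rightarrow> 'o set \<Rightarrow> bool" where
  "full_subcategory C S \<longleftrightarrow> S \<subseteq> Obj C \<and>
     (\<forall>X \<in> S. \<forall>Y \<in> Obj C. isomorphic C X Y \<longrightarrow> Y \<in> S) \<and>
     additive_category (full_subcat C S)"

definition is_kernel :: "('o, 'a, 'x) preadditive_data_scheme \<Rightarrow> 'a \<Rightarrow> 'a \<Rightarrow> bool" where
  "is_kernel C k g \<longleftrightarrow> k \<in> Arr C \<and> g \<in> Arr C \<and> Cod C k = Dom C g \<and>
     Cmp C g k = Zro C (Dom C k) (Cod C g) \<and>
     (\<forall>h \<in> Arr C. Cod C h = Dom C g \<and> Cmp C g h = Zro C (Dom C h) (Cod C g) \<longrightarrow>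
        (\<exists>!l. l \<in> Hom C (Dom C h) (Dom C k) \<and> Cmp C k l = h))"

definition is_cokernel :: "('o, 'a, 'x) preadditive_data_scheme \<Rightarrow> 'a \<Rightarrow> 'a \<Rightarrow> bool" where
  "is_cokernel C c f \<longleftrightarrow> c \<in> Arr C \<and> f \<in> Arr C \<and> Dom C c = Cod C f \<and>
     Cmp C c f = Zro C (Dom C f) (Cod C c) \<and>
     (\<forall>h \<in> Arr C. Dom C h = Cod C f \<and> Cmp C h f = Zro C (Dom C f) (Cod C h) \<longrightarrow>
        (\<exists>!l. l \<in> Hom C (Cod C c) (Cod C h) \<and> Cmp C l c = h))"

definition short_exact :: "('o, 'a, 'x) preadditive_data_scheme \<Rightarrow> 'a \<Rightarrow> 'a \<Rightarrow> bool" where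
  "short_exact C f g \<longleftrightarrow> is_kernel C f g \<and> is_cokernel C g f"

text \<open>Torsion pairs are used for hearts of t-structures only, which are abelian categories by a
  theorem; so abelianness is not made part of the definition.\<close>

definition torsion_pair ::
    "('o, 'a, 'x) preadditive_data_scheme \<Rightarrow> 'o set \<Rightarrow> 'o set \<Rightarrow> bool" where
  "torsion_pair A \<X> \<Y> \<longleftrightarrow> full_subcategory A \<X> \<and> full_subcategory A \<Y> \<and>
     (\<forall>X \<in> \<X>. \<forall>Y \<in> \<Y>. Hom A X Y = {Zro A X Y}) \<and>
     (\<forall>M \<in> Obj A. \<exists>X \<in> \<X>. \<exists>Y \<in> \<Y>. \<exists>f \<in> Hom A X M. \<exists>g \<in> Hom A M Y. short_exact A f g)"


section \<open>Triangulated categories\<close>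

text \<open>The shift is an automorphism of the category, as in Verdier's definition. A triangle
  is given by its three morphisms, \<open>(f, g, h)\<close> standing for
  \<open>X \<rightarrow> Y \<rightarrow> Z \<rightarrow> X[1]\<close>.\<close>

record ('o, 'a) triangulated_data = "('o, 'a) preadditive_data" +
  ShO :: "'o \<Rightarrow> 'o"
  ShA :: "'a \<Rightarrow> 'a"
  Dist :: "('a \<times> 'a \<times> 'a) set"

definition triangle ::
    "('o, 'a, 'x) triangulated_data_scheme \<Rightarrow> 'a \<Rightarrow> 'a \<Rightarrow> 'a \<Rightarrow> bool" where
  "triangle C f g h \<longleftrightarrow> f \<in> Arr C \<and> g \<in> Hom C (Cod C f) (Dom C h) \<and>
     h \<in> Hom C (Cod C g) (ShO C (Dom C f))"

definition triangle_morphism ::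
    "('o, 'a, 'x) triangulated_data_scheme \<Rightarrow> 'a \<times> 'a \<times> 'a \<Rightarrow> 'a \<times> 'a \<times> 'a \<Rightarrow>
       'a \<Rightarrow> 'a \<Rightarrow> 'a \<Rightarrow> bool" where
  "triangle_morphism C t t' a b c \<longleftrightarrow> (case (t, t') of ((f, g, h), (f', g', h')) \<Rightarrow>
     a \<in> Hom C (Dom C f) (Dom C f') \<and>
     b \<in> Hom C (Dom C g) (Dom C g') \<and>
     c \<in> Hom C (Dom C h) (Dom C h') \<and>
     Cmp C b f = Cmp C f' a \<and> Cmp C c g = Cmp C g' b \<and> Cmp C (ShA C a) h = Cmp C h' c)"

locale triangulated_category = additive_category C
  for C :: "('o, 'a, 'x) triangulated_data_scheme" (structure) +
  assumes ShO_bij: "bij_betw (ShO C) (Obj C) (Obj C)"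
    and ShA_bij: "bij_betw (ShA C) (Arr C) (Arr C)"
    and ShA_in_Hom: "f \<in> Hom C X Y \<Longrightarrow> ShA C f \<in> Hom C (ShO C X) (ShO C Y)"
    and ShA_Idn: "X \<in> Obj C \<Longrightarrow> ShA C (Idn C X) = Idn C (ShO C X)"
    and ShA_Cmp: "\<lbrakk>g \<in> Hom C Y Z; f \<in> Hom C X Y\<rbrakk> \<Longrightarrow> ShA C (g \<cdot> f) = ShA C g \<cdot> ShA C f"
    and ShA_Add: "\<lbrakk>f \<in> Hom C X Y; f' \<in> Hom C X Y\<rbrakk> \<Longrightarrow> ShA C (f \<oplus> f') = ShA C f \<oplus> ShA C f'"
    and Dist_triangle: "(f, g, h) \<in> Dist C \<Longrightarrow> triangle C f g h"
    and TR1_iso: "\<lbrakk>(f, g, h) \<in> Dist C; triangle C f' g' h';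
        triangle_morphism C (f, g, h) (f', g', h') a b c; is_iso C a; is_iso C b; is_iso C c\<rbrakk>
      \<Longrightarrow> (f', g', h') \<in> Dist C"
    and TR1_id: "\<lbrakk>X \<in> Obj C; Z \<in> zero_objects C\<rbrakk>
      \<Longrightarrow> (Idn C X, Zro C X Z, Zro C Z (ShO C X)) \<in> Dist C"
    and TR1_cone: "f \<in> Arr C \<Longrightarrow> \<exists>g h. (f, g, h) \<in> Dist C"
    and TR2: "triangle C f g h \<Longrightarrow> (f, g, h) \<in> Dist C \<longleftrightarrow> (g, h, Neg C (ShA C f)) \<in> Dist C"
    and TR3: "\<lbrakk>(f, g, h) \<in> Dist C; (f', g', h') \<in> Dist C;
        a \<in> Hom C (Dom C f) (Dom C f'); b \<in> Hom C (Dom C g) (Dom C g'); b \<cdot> f = f' \<cdot> a\<rbrakk>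
      \<Longrightarrow> \<exists>c. triangle_morphism C (f, g, h) (f', g', h') a b c"
    and TR4: "\<lbrakk>f \<in> Hom C X Y; g \<in> Hom C Y Z;
        (f, u, u') \<in> Dist C; (g, v, v') \<in> Dist C; (g \<cdot> f, w, w') \<in> Dist C\<rbrakk>
      \<Longrightarrow> \<exists>a \<in> Hom C (Cod C u) (Cod C w). \<exists>b \<in> Hom C (Cod C w) (Cod C v).
            (a, b, ShA C u \<cdot> v') \<in> Dist C \<and>
            a \<cdot> u = w \<cdot> g \<and> w' \<cdot> a = u' \<and> b \<cdot> w = v \<and> v' \<cdot> b = ShA C f \<cdot> w'"

definition shift :: "('o, 'a, 'x) triangulated_data_scheme \<Rightarrow> int \<Rightarrow> 'o \<Rightarrow> 'o" where
  "shift C n X = (if 0 \<le> n then (ShO C ^^ nat n) X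
                  else (inv_into (Obj C) (ShO C) ^^ nat (- n)) X)"


section \<open>t-structures\<close>

type_synonym 'o t_pair = "'o set \<times> 'o set"

abbreviation aisle :: "'o t_pair \<Rightarrow> 'o set" where "aisle \<equiv> fst"
abbreviation coaisle :: "'o t_pair \<Rightarrow> 'o set" where "coaisle \<equiv> snd"

definition t_le :: "('o, 'a, 'x) triangulated_data_scheme \<Rightarrow> 'o t_pair \<Rightarrow> int \<Rightarrow> 'o set" where
  "t_le C D i = shift C (- i) ` aisle D"

definition t_ge :: "('o, 'a, 'x) triangulated_data_scheme \<Rightarrow> 'o t_pair \<Rightarrow> int \<Rightarrow> 'o set" where
  "t_ge C D i = shift C (- i) ` coaisle D"

definition truncation_triangle ::
    "('o, 'a, 'x) triangulated_data_scheme \<Rightarrow> 'o t_pair \<Rightarrow> int \<Rightarrow> 'o \<Rightarrow> 'o \<Rightarrow> 'o \<Rightarrow> bool" where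
  "truncation_triangle C D n A X B \<longleftrightarrow> A \<in> t_le C D n \<and> B \<in> t_ge C D (n + 1) \<and>
     (\<exists>f \<in> Hom C A X. \<exists>g \<in> Hom C X B. \<exists>h \<in> Hom C B (ShO C A). (f, g, h) \<in> Dist C)"

text \<open>All t-structures considered are non-degenerate; the last two conditions say this.\<close>

definition t_structure :: "('o, 'a, 'x) triangulated_data_scheme \<Rightarrow> 'o t_pair \<Rightarrow> bool" where
  "t_structure C D \<longleftrightarrow> full_subcategory C (aisle D) \<and> full_subcategory C (coaisle D) \<and>
     (\<forall>X \<in> t_le C D 0. \<forall>Y \<in> t_ge C D 1. Hom C X Y = {Zro C X Y}) \<and>
     t_le C D 0 \<subseteq> t_le C D 1 \<and> t_ge C D 1 \<subseteq> t_ge C D 0 \<and>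
     (\<forall>X \<in> Obj C. \<exists>A B. truncation_triangle C D 0 A X B) \<and>
     (\<Inter>i. t_le C D i) = zero_objects C \<and> (\<Inter>i. t_ge C D i) = zero_objects C"

definition heart :: "('o, 'a, 'x) triangulated_data_scheme \<Rightarrow> 'o t_pair \<Rightarrow>
    ('o, 'a, 'x) triangulated_data_scheme" where
  "heart C D = full_subcat C (aisle D \<inter> coaisle D)"

text \<open>The truncation functors and the cohomological functors on objects. They are determined up to
  isomorphism; only membership of their values in subcategories closed under isomorphisms
  matters, and their action on morphisms is not needed.\<close>

definition trunc_le :: "('o, 'a, 'x) triangulated_data_scheme \<Rightarrow> 'o t_pair \<Rightarrow> int \<Rightarrow> 'o \<Rightarrow> 'o" where
  "trunc_le C D n X = (SOME A. \<exists>B. truncation_triangle C D n A X B)"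

definition trunc_ge :: "('o, 'a, 'x) triangulated_data_scheme \<Rightarrow> 'o t_pair \<Rightarrow> int \<Rightarrow> 'o \<Rightarrow> 'o" where
  "trunc_ge C D n X = (SOME B. \<exists>A. truncation_triangle C D (n - 1) A X B)"

definition cohomology ::
    "('o, 'a, 'x) triangulated_data_scheme \<Rightarrow> 'o t_pair \<Rightarrow> int \<Rightarrow> 'o \<Rightarrow> 'o" where
  "cohomology C D i X = trunc_ge C D 0 (trunc_le C D 0 (shift C i X))"

definition right_filterable ::
    "('o, 'a, 'x) triangulated_data_scheme \<Rightarrow> 'o t_pair \<Rightarrow> 'o t_pair \<Rightarrow> bool" where
  "right_filterable C D T \<longleftrightarrow>
     (\<forall>i. \<exists>S. t_structure C S \<and> coaisle S = t_ge C D i \<inter> t_ge C T 0)"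

definition tilt ::
    "('o, 'a, 'x) triangulated_data_scheme \<Rightarrow> 'o t_pair \<Rightarrow> 'o set \<Rightarrow> 'o set \<Rightarrow> 'o t_pair" where
  "tilt C E \<X> \<Y> =
     ({X \<in> Obj C. cohomology C E 0 X \<in> \<X> \<and> (\<forall>i > 0. cohomology C E i X \<in> zero_objects C)},
      {X \<in> Obj C. cohomology C E (-1) X \<in> \<Y> \<and> (\<forall>i < -1. cohomology C E i X \<in> zero_objects C)})"

definition iterated_HRS ::
    "('o, 'a, 'x) triangulated_data_scheme \<Rightarrow> nat \<Rightarrow> 'o t_pair \<Rightarrow> 'o t_pair \<Rightarrow> bool" where
  "iterated_HRS C m D T \<longleftrightarrow>
     (\<exists>E. E 0 = D \<and> E m = T \<and> (\<forall>i \<le> m. t_structure C (E i)) \<and>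
        (\<forall>i < m. \<exists>\<X> \<Y>. torsion_pair (heart C (E i)) \<X> \<Y> \<and> E (Suc i) = tilt C (E i) \<X> \<Y>))"

end

theory Submission
  imports Defs
begin

text \<open>
  The idea is that a t-structure between \<open>D\<close> and a shift of \<open>D\<close> by one is always a tilt of
  \<open>D\<close>, and that right filterability cuts the passage from \<open>D\<close> to \<open>T\<close> into \<open>m\<close> such short
  passages.

  Suppose that \<open>E\<close> and \<open>F\<close> are t-structures whose co-aisles satisfy
  \<open>E\<^sup>\<ge>\<^sup>0 \<subseteq> F\<^sup>\<ge>\<^sup>0 \<subseteq> E\<^sup>\<ge>\<^sup>-\<^sup>1\<close>. Truncating an object of the heart of \<open>E\<close> with respect to \<open>F\<close> gives a
  triangle in which all three terms lie in the heart, hence a short exact sequence there. So the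
  objects of the heart that lie in \<open>F\<^sup>\<le>\<^sup>0\<close>, and those that lie in \<open>F\<^sup>\<ge>\<^sup>1\<close>, form a torsion pair. Since
  \<open>F\<close> contains \<open>E\<^sup>\<le>\<^sup>-\<^sup>1\<close> in its aisle and \<open>E\<^sup>\<ge>\<^sup>0\<close> in its co-aisle, membership in the aisle or co-aisle
  of \<open>F\<close> can be read off from a single cohomology object, and \<open>F\<close> is the tilt of \<open>E\<close>
  (\<open>tilt_of_intermediate\<close>).

  Now let \<open>D\<^sup>\<ge>\<^sup>0 \<subseteq> T\<^sup>\<ge>\<^sup>0 \<subseteq> D\<^sup>\<ge>\<^sup>-\<^sup>m\<close>. By right filterability \<open>D\<^sup>\<ge>\<^sup>-\<^sup>i \<inter> T\<^sup>\<ge>\<^sup>0\<close> is the co-aisle of a t-structure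
  \<open>E\<^sub>i\<close>. A t-structure is determined by its co-aisle, so \<open>E\<^sub>0\<close> is \<open>D\<close> and \<open>E\<^sub>m\<close> is \<open>T\<close>; and
  consecutive members are in the position just described (\<open>iterated_HRS_if_bounds\<close>). Conversely,
  one tilt of \<open>E\<close> squeezes the new aisle between \<open>E\<^sup>\<le>\<^sup>-\<^sup>1\<close> and \<open>E\<^sup>\<le>\<^sup>0\<close> (\<open>tilt_bounds\<close>), and these
  estimates add up (\<open>iterated_HRS_bounds\<close>). The equivalence of the bounds on aisles with those on
  co-aisles holds because each of the two classes is the orthogonal of a shift of the other.

  The tilt is defined by vanishing of cohomology objects, so its use depends on the fact that
  \<open>H\<^sup>i X = 0\<close> for all \<open>i > k\<close> implies \<open>X \<in> E\<^sup>\<le>\<^sup>k\<close>, and dually. Here non-degeneracy enters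
  (\<open>t_le_if_cohomology_zero\<close>, \<open>t_ge_if_cohomology_zero\<close>).
\<close>

section \<open>Zero morphisms and negatives\<close>

context preadditive_category
begin

lemma Hom_objs:
  assumes "f \<in> Hom C X Y"
  shows "X \<in> Obj C" "Y \<in> Obj C"
  using assms Dom_closed Cod_closed unfolding Hom_def by auto

lemma Zro_in_Hom:
  assumes "X \<in> Obj C" "Y \<in> Obj C"
  shows "Zro C X Y \<in> Hom C X Y"
proof -
  interpret G: comm_group "Hom_group C X Y" using Hom_comm_group assms .
  show ?thesis using G.one_closed by (simp add: Hom_group_def)
qed

lemma Add_in_Hom:
  assumes "f \<in> Hom C X Y" "g \<in> Hom C X Y"
  shows "f \<oplus> g \<in> Hom C X Y"
proof -
  interpret G: comm_group "Hom_group C X Y" using Hom_comm_group Hom_objs[OF assms(1)] .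
  show ?thesis using G.m_closed assms by (simp add: Hom_group_def)
qed

lemma Add_Zro:
  assumes "f \<in> Hom C X Y"
  shows "f \<oplus> Zro C X Y = f" "Zro C X Y \<oplus> f = f"
proof -
  interpret G: comm_group "Hom_group C X Y" using Hom_comm_group Hom_objs[OF assms(1)] .
  show "f \<oplus> Zro C X Y = f" "Zro C X Y \<oplus> f = f"
    using G.r_one G.l_one assms by (simp_all add: Hom_group_def)
qed

lemma Add_idem_imp_Zro:
  assumes "f \<in> Hom C X Y" "f \<oplus> f = f"
  shows "f = Zro C X Y"
proof -
  interpret G: comm_group "Hom_group C X Y" using Hom_comm_group Hom_objs[OF assms(1)] .
  show ?thesis using G.l_cancel_one assms by (simp add: Hom_group_def)
qed

lemma Neg_in_Hom:
  assumes "f \<in> Hom C X Y"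
  shows "Neg C f \<in> Hom C X Y"
proof -
  interpret G: comm_group "Hom_group C X Y" using Hom_comm_group Hom_objs[OF assms(1)] .
  show ?thesis using G.inv_closed[of f] assms by (simp add: Hom_group_def Neg_def Hom_def)
qed

lemma Add_Neg:
  assumes "f \<in> Hom C X Y"
  shows "f \<oplus> Neg C f = Zro C X Y" "Neg C f \<oplus> f = Zro C X Y"
proof -
  interpret G: comm_group "Hom_group C X Y" using Hom_comm_group Hom_objs[OF assms(1)] .
  show "f \<oplus> Neg C f = Zro C X Y" "Neg C f \<oplus> f = Zro C X Y"
    using G.r_inv[of f] G.l_inv[of f] assms by (simp_all add: Hom_group_def Neg_def Hom_def)
qed

lemma Neg_unique:
  assumes "f \<in> Hom C X Y" "g \<in> Hom C X Y" "g \<oplus> f = Zro C X Y"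
  shows "g = Neg C f"
proof -
  interpret G: comm_group "Hom_group C X Y" using Hom_comm_group Hom_objs[OF assms(1)] .
  show ?thesis using G.inv_equality[of g f] assms by (simp add: Hom_group_def Neg_def Hom_def)
qed

lemma Neg_Neg:
  assumes "f \<in> Hom C X Y"
  shows "Neg C (Neg C f) = f"
  using Neg_unique[OF Neg_in_Hom[OF assms] assms] Add_Neg[OF assms] by simp

lemma eq_if_diff_Zro:
  assumes "f \<in> Hom C X Y" "g \<in> Hom C X Y" "f \<oplus> Neg C g = Zro C X Y"
  shows "f = g"
  using Neg_unique[OF Neg_in_Hom[OF assms(2)] assms(1) assms(3)] Neg_Neg[OF assms(2)] by simp

lemma Cmp_Zro_left:
  assumes "f \<in> Hom C X Y" "Z \<in> Obj C"
  shows "Zro C Y Z \<cdot> f = Zro C X Z"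
proof (rule Add_idem_imp_Zro)
  have z: "Zro C Y Z \<in> Hom C Y Z" using Zro_in_Hom Hom_objs assms by blast
  show "Zro C Y Z \<cdot> f \<in> Hom C X Z" using Cmp_in_Hom z assms(1) .
  show "Zro C Y Z \<cdot> f \<oplus> Zro C Y Z \<cdot> f = Zro C Y Z \<cdot> f"
    using Cmp_Add_left[OF z z assms(1)] Add_Zro[OF z] by simp
qed

lemma Cmp_Zro_right:
  assumes "g \<in> Hom C Y Z" "X \<in> Obj C"
  shows "g \<cdot> Zro C X Y = Zro C X Z"
proof (rule Add_idem_imp_Zro)
  have z: "Zro C X Y \<in> Hom C X Y" using Zro_in_Hom Hom_objs assms by blast
  show "g \<cdot> Zro C X Y \<in> Hom C X Z" using Cmp_in_Hom assms(1) z .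
  show "g \<cdot> Zro C X Y \<oplus> g \<cdot> Zro C X Y = g \<cdot> Zro C X Y"
    using Cmp_Add_right[OF assms(1) z z] Add_Zro[OF z] by simp
qed

lemma Neg_Cmp:
  assumes "g \<in> Hom C Y Z" "f \<in> Hom C X Y"
  shows "Neg C g \<cdot> f = Neg C (g \<cdot> f)"
proof (rule Neg_unique)
  show "g \<cdot> f \<in> Hom C X Z" "Neg C g \<cdot> f \<in> Hom C X Z"
    using Cmp_in_Hom Neg_in_Hom assms by blast+
  show "Neg C g \<cdot> f \<oplus> g \<cdot> f = Zro C X Z"
    using Cmp_Add_left[OF Neg_in_Hom[OF assms(1)] assms] Add_Neg[OF assms(1)]
      Cmp_Zro_left[OF assms(2)] Hom_objs[OF assms(1)] by simp
qed

lemma Cmp_Neg: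
  assumes "g \<in> Hom C Y Z" "f \<in> Hom C X Y"
  shows "g \<cdot> Neg C f = Neg C (g \<cdot> f)"
proof (rule Neg_unique)
  show "g \<cdot> f \<in> Hom C X Z" "g \<cdot> Neg C f \<in> Hom C X Z"
    using Cmp_in_Hom Neg_in_Hom assms by blast+
  show "g \<cdot> Neg C f \<oplus> g \<cdot> f = Zro C X Z"
    using Cmp_Add_right[OF assms(1) Neg_in_Hom[OF assms(2)] assms(2)] Add_Neg[OF assms(2)]
      Cmp_Zro_right[OF assms(1)] Hom_objs[OF assms(2)] by simp
qed

lemma Cmp_diff_right:
  assumes "f \<in> Hom C Y Z" "v \<in> Hom C X Y" "w \<in> Hom C X Y" "f \<cdot> v = f \<cdot> w"
  shows "f \<cdot> (v \<oplus> Neg C w) = Zro C X Z"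
  using assms Cmp_Add_right[OF assms(1,2) Neg_in_Hom[OF assms(3)]] Cmp_Neg[OF assms(1,3)]
    Add_Neg[OF Cmp_in_Hom[OF assms(1,3)]] by simp

lemma Cmp_diff_left:
  assumes "v \<in> Hom C Y Z" "w \<in> Hom C Y Z" "f \<in> Hom C X Y" "v \<cdot> f = w \<cdot> f"
  shows "(v \<oplus> Neg C w) \<cdot> f = Zro C X Z"
  using assms Cmp_Add_left[OF assms(1) Neg_in_Hom[OF assms(2)] assms(3)] Neg_Cmp[OF assms(2,3)]
    Add_Neg[OF Cmp_in_Hom[OF assms(2,3)]] by simp

definition orthogonal :: "'o \<Rightarrow> 'o \<Rightarrow> bool" where
  "orthogonal X Y \<longleftrightarrow> Hom C X Y = {Zro C X Y}"

lemma orthogonalD: "orthogonal X Y \<Longrightarrow> f \<in> Hom C X Y \<Longrightarrow> f = Zro C X Y"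
  by (simp add: orthogonal_def)

lemma orthogonalI:
  assumes "X \<in> Obj C" "Y \<in> Obj C" "\<And>f. f \<in> Hom C X Y \<Longrightarrow> f = Zro C X Y"
  shows "orthogonal X Y"
  using assms Zro_in_Hom unfolding orthogonal_def by blast

lemma zero_object_if_self_orthogonal:
  assumes "Z \<in> Obj C" "orthogonal Z Z"
  shows "Z \<in> zero_objects C"
proof -
  have id: "Idn C Z = Zro C Z Z" using orthogonalD assms Idn_in_Hom by blast
  have "f = Zro C X Z" if "f \<in> Hom C X Z" for f X
    using Cmp_Idn_left[OF that] Cmp_Zro_left[OF that assms(1)] id by simp
  moreover have "f = Zro C Z X" if "f \<in> Hom C Z X" for f X
    using Cmp_Idn_right[OF that] Cmp_Zro_right[OF that assms(1)] id by simp
  ultimately show ?thesis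
    unfolding zero_objects_def using assms(1) Zro_in_Hom by blast
qed

lemma zero_object_orthogonal:
  assumes "Z \<in> zero_objects C" "X \<in> Obj C"
  shows "orthogonal Z X" "orthogonal X Z"
  using assms Zro_in_Hom[of Z X] Zro_in_Hom[of X Z] unfolding zero_objects_def orthogonal_def by auto

lemma zero_object_Obj: "Z \<in> zero_objects C \<Longrightarrow> Z \<in> Obj C"
  by (simp add: zero_objects_def)


section \<open>Orthogonal classes of objects\<close>

definition retract :: "'o \<Rightarrow> 'o \<Rightarrow> bool" where
  "retract X Y \<longleftrightarrow> (\<exists>a \<in> Hom C X Y. \<exists>b \<in> Hom C Y X. b \<cdot> a = Idn C X)"

definition left_perp :: "'o set \<Rightarrow> 'o set" where
  "left_perp S = {X \<in> Obj C. \<forall>Y \<in> S. orthogonal X Y}"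

definition right_perp :: "'o set \<Rightarrow> 'o set" where
  "right_perp S = {Y \<in> Obj C. \<forall>X \<in> S. orthogonal X Y}"

lemma left_perp_retract:
  assumes "S \<subseteq> Obj C" "retract X Y" "Y \<in> left_perp S"
  shows "X \<in> left_perp S"
proof -
  obtain a b where a: "a \<in> Hom C X Y" and b: "b \<in> Hom C Y X" and ba: "b \<cdot> a = Idn C X"
    using assms(2) unfolding retract_def by blast
  have "orthogonal X W" if "W \<in> S" for W
  proof (rule orthogonalI)
    show "X \<in> Obj C" "W \<in> Obj C" using Hom_objs[OF a] that assms(1) by auto
    fix f assume f: "f \<in> Hom C X W"
    have "f = (f \<cdot> b) \<cdot> a" using Cmp_assoc[OF f b a] ba Cmp_Idn_right[OF f] by simp
    moreover have "f \<cdot> b = Zro C Y W"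
      using orthogonalD Cmp_in_Hom[OF f b] assms(3) that unfolding left_perp_def by blast
    ultimately show "f = Zro C X W" using Cmp_Zro_left[OF a \<open>W \<in> Obj C\<close>] by simp
  qed
  then show ?thesis using Hom_objs[OF a] unfolding left_perp_def by blast
qed

lemma right_perp_retract:
  assumes "S \<subseteq> Obj C" "retract X Y" "Y \<in> right_perp S"
  shows "X \<in> right_perp S"
proof -
  obtain a b where a: "a \<in> Hom C X Y" and b: "b \<in> Hom C Y X" and ba: "b \<cdot> a = Idn C X"
    using assms(2) unfolding retract_def by blast
  have "orthogonal W X" if "W \<in> S" for W
  proof (rule orthogonalI)
    show "X \<in> Obj C" "W \<in> Obj C" using Hom_objs[OF a] that assms(1) by auto
    fix f assume f: "f \<in> Hom C W X"
    have "f = b \<cdot> (a \<cdot> f)" using Cmp_assoc[OF b a f] ba Cmp_Idn_left[OF f] by simp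
    moreover have "a \<cdot> f = Zro C W Y"
      using orthogonalD Cmp_in_Hom[OF a f] assms(3) that unfolding right_perp_def by blast
    ultimately show "f = Zro C W X" using Cmp_Zro_right[OF b \<open>W \<in> Obj C\<close>] by simp
  qed
  then show ?thesis using Hom_objs[OF a] unfolding right_perp_def by blast
qed

lemma left_perp_biproduct:
  assumes "S \<subseteq> Obj C" "X \<in> left_perp S" "Y \<in> left_perp S" "is_biproduct C X Y P"
  shows "P \<in> left_perp S"
proof -
  obtain i j p q where i: "i \<in> Hom C X P" and j: "j \<in> Hom C Y P" and p: "p \<in> Hom C P X"
    and q: "q \<in> Hom C P Y" and sum: "i \<cdot> p \<oplus> j \<cdot> q = Idn C P" and P: "P \<in> Obj C"
    using assms(4) unfolding is_biproduct_def by blast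
  have "orthogonal P W" if W: "W \<in> S" for W
  proof (rule orthogonalI)
    show "P \<in> Obj C" "W \<in> Obj C" using P W assms(1) by auto
    fix f assume f: "f \<in> Hom C P W"
    have z: "f \<cdot> i = Zro C X W" "f \<cdot> j = Zro C Y W"
      using orthogonalD Cmp_in_Hom[OF f i] Cmp_in_Hom[OF f j] assms(2,3) W
      unfolding left_perp_def by blast+
    have "f = f \<cdot> (i \<cdot> p \<oplus> j \<cdot> q)" using sum Cmp_Idn_right[OF f] by simp
    also have "\<dots> = (f \<cdot> i) \<cdot> p \<oplus> (f \<cdot> j) \<cdot> q"
      using Cmp_Add_right[OF f Cmp_in_Hom[OF i p] Cmp_in_Hom[OF j q]]
        Cmp_assoc[OF f i p] Cmp_assoc[OF f j q] by simp
    also have "\<dots> = Zro C P W"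
      using z Cmp_Zro_left[OF p \<open>W \<in> Obj C\<close>] Cmp_Zro_left[OF q \<open>W \<in> Obj C\<close>]
        Add_Zro[OF Zro_in_Hom[OF P \<open>W \<in> Obj C\<close>]] by simp
    finally show "f = Zro C P W" .
  qed
  then show ?thesis using P unfolding left_perp_def by blast
qed

lemma right_perp_biproduct:
  assumes "S \<subseteq> Obj C" "X \<in> right_perp S" "Y \<in> right_perp S" "is_biproduct C X Y P"
  shows "P \<in> right_perp S"
proof -
  obtain i j p q where i: "i \<in> Hom C X P" and j: "j \<in> Hom C Y P" and p: "p \<in> Hom C P X"
    and q: "q \<in> Hom C P Y" and sum: "i \<cdot> p \<oplus> j \<cdot> q = Idn C P" and P: "P \<in> Obj C"
    using assms(4) unfolding is_biproduct_def by blast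
  have "orthogonal W P" if W: "W \<in> S" for W
  proof (rule orthogonalI)
    show "P \<in> Obj C" "W \<in> Obj C" using P W assms(1) by auto
    fix f assume f: "f \<in> Hom C W P"
    have z: "p \<cdot> f = Zro C W X" "q \<cdot> f = Zro C W Y"
      using orthogonalD Cmp_in_Hom[OF p f] Cmp_in_Hom[OF q f] assms(2,3) W
      unfolding right_perp_def by blast+
    have "f = (i \<cdot> p \<oplus> j \<cdot> q) \<cdot> f" using sum Cmp_Idn_left[OF f] by simp
    also have "\<dots> = i \<cdot> (p \<cdot> f) \<oplus> j \<cdot> (q \<cdot> f)"
      using Cmp_Add_left[OF Cmp_in_Hom[OF i p] Cmp_in_Hom[OF j q] f]
        Cmp_assoc[OF i p f] Cmp_assoc[OF j q f] by simp
    also have "\<dots> = Zro C W P"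
      using z Cmp_Zro_right[OF i \<open>W \<in> Obj C\<close>] Cmp_Zro_right[OF j \<open>W \<in> Obj C\<close>]
        Add_Zro[OF Zro_in_Hom[OF \<open>W \<in> Obj C\<close> P]] by simp
    finally show "f = Zro C W P" .
  qed
  then show ?thesis using P unfolding right_perp_def by blast
qed

text \<open>Orthogonal classes have all of the following closure properties, and the properties survive
  intersections. This is how hearts and torsion classes are recognised as full additive
  subcategories. Retracts are used in place of isomorphic objects because a comparison of two
  triangles then needs only one of the two composites.\<close>

definition additive_class :: "'o set \<Rightarrow> bool" where
  "additive_class S \<longleftrightarrow> S \<subseteq> Obj C \<and> zero_objects C \<subseteq> S \<and>
     (\<forall>X Y. retract X Y \<longrightarrow> Y \<in> S \<longrightarrow> X \<in> S) \<and>
     (\<forall>X Y P. X \<in> S \<longrightarrow> Y \<in> S \<longrightarrow> is_biproduct C X Y P \<longrightarrow> P \<in> S)"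

lemma additive_classD:
  assumes "additive_class S"
  shows "S \<subseteq> Obj C" "zero_objects C \<subseteq> S" "retract X Y \<Longrightarrow> Y \<in> S \<Longrightarrow> X \<in> S"
    "X \<in> S \<Longrightarrow> Y \<in> S \<Longrightarrow> is_biproduct C X Y P \<Longrightarrow> P \<in> S"
proof -
  note S = assms[unfolded additive_class_def]
  show "S \<subseteq> Obj C" by (rule S[THEN conjunct1])
  show "zero_objects C \<subseteq> S" by (rule S[THEN conjunct2, THEN conjunct1])
  show "X \<in> S" if "retract X Y" "Y \<in> S"
    using S[THEN conjunct2, THEN conjunct2, THEN conjunct1, rule_format, OF that] .
  show "P \<in> S" if "X \<in> S" "Y \<in> S" "is_biproduct C X Y P"
    using S[THEN conjunct2, THEN conjunct2, THEN conjunct2, rule_format, OF that] .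
qed

lemma additive_class_left_perp:
  assumes "S \<subseteq> Obj C"
  shows "additive_class (left_perp S)"
  unfolding additive_class_def
proof (intro conjI allI impI)
  show "left_perp S \<subseteq> Obj C" by (auto simp: left_perp_def)
  show "zero_objects C \<subseteq> left_perp S"
    using zero_object_orthogonal(1) zero_object_Obj assms unfolding left_perp_def by blast
qed (fact left_perp_retract[OF assms] left_perp_biproduct[OF assms])+

lemma additive_class_right_perp:
  assumes "S \<subseteq> Obj C"
  shows "additive_class (right_perp S)"
  unfolding additive_class_def
proof (intro conjI allI impI)
  show "right_perp S \<subseteq> Obj C" by (auto simp: right_perp_def)
  show "zero_objects C \<subseteq> right_perp S"
    using zero_object_orthogonal(2) zero_object_Obj assms unfolding right_perp_def by blast
qed (fact right_perp_retract[OF assms] right_perp_biproduct[OF assms])+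

lemma additive_class_Int:
  assumes "additive_class S" "additive_class S'"
  shows "additive_class (S \<inter> S')"
  using assms unfolding additive_class_def
  by (intro conjI) (blast, blast, meson IntD1 IntD2 IntI, meson IntD1 IntD2 IntI)

lemma isomorphic_imp_retract:
  assumes "isomorphic C X Y"
  shows "retract Y X"
  using assms unfolding isomorphic_def is_iso_def retract_def Hom_def by auto

end

lemma Hom_full_subcat:
  "Hom (full_subcat C S) X Y = (if X \<in> S \<and> Y \<in> S then Hom C X Y else {})"
  by (auto simp: Hom_def full_subcat_def)

lemma full_subcat_simps:
  "Obj (full_subcat C S) = S" "Dom (full_subcat C S) = Dom C" "Cod (full_subcat C S) = Cod C"
  "Idn (full_subcat C S) = Idn C" "Cmp (full_subcat C S) = Cmp C"
  "Arr (full_subcat C S) = {f \<in> Arr C. Dom C f \<in> S \<and> Cod C f \<in> S}"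
  by (simp_all add: full_subcat_def)

lemma full_subcat_preadditive_simps:
  "Add (full_subcat C S) = Add C" "Zro (full_subcat C S) = Zro C"
  by (simp_all add: full_subcat_def)

lemma full_subcat_full_subcat: "S' \<subseteq> S \<Longrightarrow> full_subcat (full_subcat C S) S' = full_subcat C S'"
  unfolding full_subcat_def
  by (auto intro!: arg_cong2[where f = "\<lambda>f g. Arr_update f (Obj_update g C)"])

context additive_category
begin

lemma additive_category_full_subcat:
  assumes S: "additive_class S"
  shows "additive_category (full_subcat C S)"
proof -
  let ?A = "full_subcat C S"
  have SO: "X \<in> Obj C" if "X \<in> S" for X using S that unfolding additive_class_def by blast
  note simps = Hom_full_subcat full_subcat_simps full_subcat_preadditive_simps
  have hom: "f \<in> Hom ?A X Y \<longleftrightarrow> f \<in> Hom C X Y \<and> X \<in> S \<and> Y \<in> S" for f X Y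
    by (simp add: simps)
  have 1: "category ?A"
  proof (unfold_locales, goal_cases)
    case (1 f) then show ?case by (simp add: simps)
  next
    case (2 f) then show ?case by (simp add: simps)
  next
    case (3 X) then show ?case using Idn_in_Hom SO by (simp add: simps)
  next
    case (4 g Y Z f X) then show ?case using Cmp_in_Hom[of g Y Z f X] by (simp add: hom simps(2-))
  next
    case (5 f X Y) then show ?case using Cmp_Idn_left[of f X Y] by (simp add: hom simps(2-))
  next
    case (6 f X Y) then show ?case using Cmp_Idn_right[of f X Y] by (simp add: hom simps(2-))
  next
    case (7 h Z W g Y f X) then show ?case
      using Cmp_assoc[of h Z W g Y f X] by (simp add: hom simps(2-))
  qed
  have grp: "Hom_group ?A X Y = Hom_group C X Y" if "X \<in> S" "Y \<in> S" for X Y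
    using that by (simp add: Hom_group_def simps)
  have 2: "preadditive_category_axioms ?A"
  proof (rule preadditive_category_axioms.intro, goal_cases)
    case (1 X Y) then show ?case using Hom_comm_group SO grp by (simp add: simps)
  next
    case (2 g Y Z g' f X) then show ?case
      using Cmp_Add_left[of g Y Z g' f X] by (simp add: hom simps(2-))
  next
    case (3 g Y Z f X f') then show ?case
      using Cmp_Add_right[of g Y Z f X f'] by (simp add: hom simps(2-))
  qed
  have zero: "zero_objects C \<subseteq> zero_objects ?A"
  proof
    fix Z assume Z: "Z \<in> zero_objects C"
    then have "Z \<in> S" using S unfolding additive_class_def by blast
    then show "Z \<in> zero_objects ?A" using Z SO by (simp add: zero_objects_def simps)
  qed
  have biprod: "is_biproduct ?A X Y P"
    if "X \<in> S" "Y \<in> S" "P \<in> S" "is_biproduct C X Y P" for X Y P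
    using that unfolding is_biproduct_def by (simp add: simps)
  have 3: "additive_category_axioms ?A"
  proof (unfold_locales)
    show "zero_objects ?A \<noteq> {}" using zero zero_object_exists by blast
    fix X Y assume "X \<in> Obj ?A" "Y \<in> Obj ?A"
    then have XY: "X \<in> S" "Y \<in> S" by (simp_all add: simps)
    obtain P where P: "is_biproduct C X Y P" using biproduct_exists SO XY by blast
    then have "P \<in> S" using S XY unfolding additive_class_def by blast
    then show "\<exists>P. is_biproduct ?A X Y P" using biprod XY P by blast
  qed
  show ?thesis
    unfolding additive_category_def preadditive_category_def using 1 2 3 by blast
qed

lemma full_subcategory_of_full_subcat:
  assumes S: "additive_class S" and S': "additive_class S'" "S' \<subseteq> S"
  shows "full_subcategory (full_subcat C S) S'"
proof -
  have "Y \<in> S'" if "X \<in> S'" "isomorphic (full_subcat C S) X Y" for X Y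
  proof -
    have "isomorphic C X Y"
      using that(2) unfolding isomorphic_def is_iso_def
      by (auto simp: Hom_full_subcat full_subcat_simps split: if_splits)
    then show ?thesis
      using isomorphic_imp_retract S'(1) that(1) unfolding additive_class_def by blast
  qed
  then show ?thesis
    unfolding full_subcategory_def full_subcat_full_subcat[OF S'(2)]
    using additive_category_full_subcat[OF S'(1)] S'(2) by (auto simp: full_subcat_simps)
qed

text \<open>A zero object of the subcategory has a zero identity, hence is a zero object of the ambient
  category.\<close>

lemma full_subcategory_contains_zero_objects:
  assumes S: "S \<subseteq> Obj C" "zero_objects C \<subseteq> S" and S': "full_subcategory (full_subcat C S) S'"
    and Z: "Z \<in> zero_objects C"
  shows "Z \<in> S'"
proof -
  have sub: "S' \<subseteq> S" using S' unfolding full_subcategory_def by (simp add: full_subcat_simps)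
  have "additive_category (full_subcat C S')"
    using S' unfolding full_subcategory_def full_subcat_full_subcat[OF sub] by blast
  then obtain W where W: "W \<in> zero_objects (full_subcat C S')"
    using additive_category.zero_object_exists by blast
  then have WS: "W \<in> S'" by (simp add: zero_objects_def full_subcat_simps)
  then have WO: "W \<in> Obj C" using sub S by blast
  have "\<exists>!f. f \<in> Hom C W W"
    using W WS unfolding zero_objects_def by (simp add: full_subcat_simps Hom_full_subcat)
  then have W0: "W \<in> zero_objects C"
    using zero_object_if_self_orthogonal[OF WO] orthogonalI[OF WO WO] Zro_in_Hom[OF WO WO] by blast
  have ZO: "Z \<in> Obj C" using zero_object_Obj Z .
  define a b where "a = Zro C W Z" and "b = Zro C Z W"
  have a: "a \<in> Hom C W Z" and b: "b \<in> Hom C Z W"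
    using Zro_in_Hom ZO WO unfolding a_def b_def by blast+
  have "b \<cdot> a = Idn C W" "a \<cdot> b = Idn C Z"
    using Cmp_in_Hom a b Idn_in_Hom ZO WO zero_object_orthogonal(1)[OF W0 WO]
      zero_object_orthogonal(1)[OF Z ZO] unfolding orthogonal_def by (metis singletonD)+
  then have "isomorphic (full_subcat C S) W Z"
    unfolding isomorphic_def is_iso_def
    by (intro bexI[of _ a] conjI bexI[of _ b])
      (use a b S Z WS sub in \<open>auto simp: Hom_full_subcat full_subcat_simps Hom_def\<close>)
  then show ?thesis
    using S' WS Z S unfolding full_subcategory_def by (auto simp: full_subcat_simps)
qed

end

section \<open>Shifts\<close>

context triangulated_category
begin

lemma ShO_in_Obj: "X \<in> Obj C \<Longrightarrow> ShO C X \<in> Obj C"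
  using ShO_bij by (rule bij_betwE[rule_format])

lemma ShO_inject: "X \<in> Obj C \<Longrightarrow> Y \<in> Obj C \<Longrightarrow> ShO C X = ShO C Y \<Longrightarrow> X = Y"
  using ShO_bij unfolding bij_betw_def inj_on_def by blast

lemma shift_in_Obj:
  assumes "X \<in> Obj C"
  shows "shift C n X \<in> Obj C"
proof -
  have "(ShO C ^^ k) X \<in> Obj C" for k
    by (induction k) (simp_all add: assms ShO_in_Obj)
  moreover have "(inv_into (Obj C) (ShO C) ^^ k) X \<in> Obj C" for k
    by (induction k) (use ShO_bij in \<open>auto simp: assms bij_betw_def intro: inv_into_into\<close>)
  ultimately show ?thesis unfolding shift_def by simp
qed

lemma shift_0: "shift C 0 X = X"
  by (simp add: shift_def)

lemma shift_Suc:
  assumes "X \<in> Obj C"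
  shows "shift C (n + 1) X = ShO C (shift C n X)"
proof (cases "0 \<le> n")
  case True
  then show ?thesis by (simp add: shift_def nat_add_distrib)
next
  case False
  define k where "k = nat (- n) - 1"
  have k: "nat (- n) = Suc k" "- n - 1 = int k" using False by (simp_all add: k_def)
  have "shift C (- int k) X = (inv_into (Obj C) (ShO C) ^^ k) X"
    by (simp add: shift_def)
  moreover have "ShO C (inv_into (Obj C) (ShO C) Y) = Y" if "Y \<in> Obj C" for Y
    using ShO_bij that by (simp add: bij_betw_inv_into_right)
  ultimately have "ShO C (shift C n X) = shift C (- int k) X"
    using shift_in_Obj[OF assms, of "- int k"] k False by (simp add: shift_def)
  moreover have "n + 1 = - int k" using k by simp
  ultimately show ?thesis by simp
qed

lemma shift_add:
  assumes "X \<in> Obj C"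
  shows "shift C (m + n) X = shift C m (shift C n X)"
proof (induction m rule: int_induct[where k = 0])
  case base
  show ?case by (simp add: shift_0)
next
  case (step1 i)
  show ?case
    using step1 shift_Suc[OF assms, of "i + n"] shift_Suc[OF shift_in_Obj[OF assms], of i]
    by (simp add: algebra_simps)
next
  case (step2 i)
  have "ShO C (shift C (i - 1 + n) X) = ShO C (shift C (i - 1) (shift C n X))"
    using step2 shift_Suc[OF assms, of "i - 1 + n"] shift_Suc[OF shift_in_Obj[OF assms], of "i - 1"]
    by (simp add: algebra_simps)
  then show ?case
    using ShO_inject shift_in_Obj assms by blast
qed

lemma shift_1: "X \<in> Obj C \<Longrightarrow> shift C 1 X = ShO C X"
  using shift_Suc[of X 0] by (simp add: shift_0)

lemma ShO_shift_minus_1: "X \<in> Obj C \<Longrightarrow> ShO C (shift C (-1) X) = X"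
  using shift_Suc[of X "-1"] by (simp add: shift_0)

lemma ShA_surj:
  assumes "g \<in> Hom C (ShO C X) (ShO C Y)" "X \<in> Obj C" "Y \<in> Obj C"
  obtains f where "f \<in> Hom C X Y" "ShA C f = g"
proof -
  have "g \<in> ShA C ` Arr C"
    using assms(1) bij_betw_imp_surj_on[OF ShA_bij] by (simp add: Hom_def)
  then obtain f where f: "f \<in> Arr C" "ShA C f = g" by blast
  then have "g \<in> Hom C (ShO C (Dom C f)) (ShO C (Cod C f))"
    using ShA_in_Hom[of f "Dom C f" "Cod C f"] by (simp add: Hom_def)
  then have "ShO C (Dom C f) = ShO C X" "ShO C (Cod C f) = ShO C Y"
    using assms(1) by (simp_all add: Hom_def)
  then have "Dom C f = X" "Cod C f = Y"
    using ShO_inject[OF Dom_closed[OF f(1)] assms(2)] ShO_inject[OF Cod_closed[OF f(1)] assms(3)]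
    by simp_all
  then have "f \<in> Hom C X Y" using f(1) by (simp add: Hom_def)
  then show ?thesis using that f(2) by simp
qed

lemma ShA_inject:
  assumes "f \<in> Hom C X Y" "g \<in> Hom C X Y" "ShA C f = ShA C g"
  shows "f = g"
  using inj_onD[OF bij_betw_imp_inj_on[OF ShA_bij] assms(3)] assms(1,2) by (simp add: Hom_def)

lemma ShA_Zro:
  assumes "X \<in> Obj C" "Y \<in> Obj C"
  shows "ShA C (Zro C X Y) = Zro C (ShO C X) (ShO C Y)"
proof (rule Add_idem_imp_Zro)
  have z: "Zro C X Y \<in> Hom C X Y" using Zro_in_Hom assms .
  show "ShA C (Zro C X Y) \<in> Hom C (ShO C X) (ShO C Y)" using ShA_in_Hom z .
  show "ShA C (Zro C X Y) \<oplus> ShA C (Zro C X Y) = ShA C (Zro C X Y)"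
    using ShA_Add[OF z z] Add_Zro[OF z] by simp
qed

lemma orthogonal_ShO:
  assumes "X \<in> Obj C" "Y \<in> Obj C"
  shows "orthogonal (ShO C X) (ShO C Y) \<longleftrightarrow> orthogonal X Y"
proof
  assume o: "orthogonal (ShO C X) (ShO C Y)"
  show "orthogonal X Y"
  proof (rule orthogonalI)
    fix f assume f: "f \<in> Hom C X Y"
    have "ShA C f = ShA C (Zro C X Y)"
      using orthogonalD[OF o ShA_in_Hom[OF f]] ShA_Zro assms by simp
    then show "f = Zro C X Y" using ShA_inject f Zro_in_Hom assms by blast
  qed (use assms in auto)
next
  assume o: "orthogonal X Y"
  show "orthogonal (ShO C X) (ShO C Y)"
  proof (rule orthogonalI)
    fix g assume "g \<in> Hom C (ShO C X) (ShO C Y)"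
    then obtain f where "f \<in> Hom C X Y" "ShA C f = g" using ShA_surj assms by blast
    then show "g = Zro C (ShO C X) (ShO C Y)"
      using orthogonalD[OF o] ShA_Zro assms by auto
  qed (use assms ShO_in_Obj in auto)
qed

lemma orthogonal_shift:
  assumes "X \<in> Obj C" "Y \<in> Obj C"
  shows "orthogonal (shift C n X) (shift C n Y) \<longleftrightarrow> orthogonal X Y"
proof (induction n rule: int_induct[where k = 0])
  case base
  show ?case by (simp add: shift_0)
next
  case (step1 i)
  then show ?case using orthogonal_ShO shift_in_Obj assms by (simp add: shift_Suc)
next
  case (step2 i)
  then show ?case
    using orthogonal_ShO[of "shift C (i - 1) X" "shift C (i - 1) Y"] shift_in_Obj assms
      shift_Suc[of X "i - 1"] shift_Suc[of Y "i - 1"] by simp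
qed

section \<open>Exact triangles\<close>

definition exact :: "'a \<Rightarrow> 'a \<Rightarrow> 'a \<Rightarrow> 'o \<Rightarrow> 'o \<Rightarrow> 'o \<Rightarrow> bool" where
  "exact f g h X Y Z \<longleftrightarrow> f \<in> Hom C X Y \<and> g \<in> Hom C Y Z \<and> h \<in> Hom C Z (ShO C X) \<and> (f, g, h) \<in> Dist C"

text \<open>Closure of a class under extensions and cones depends only on the objects of a triangle.\<close>

definition exact_objects :: "'o \<Rightarrow> 'o \<Rightarrow> 'o \<Rightarrow> bool" where
  "exact_objects X Y Z \<longleftrightarrow> (\<exists>f g h. exact f g h X Y Z)"

lemma exactD:
  assumes "exact f g h X Y Z"
  shows "f \<in> Hom C X Y" "g \<in> Hom C Y Z" "h \<in> Hom C Z (ShO C X)" "(f, g, h) \<in> Dist C"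
    "X \<in> Obj C" "Y \<in> Obj C" "Z \<in> Obj C"
  using assms Hom_objs unfolding exact_def by blast+

lemma exact_rotate:
  assumes "exact f g h X Y Z"
  shows "exact g h (Neg C (ShA C f)) Y Z (ShO C X)"
  unfolding exact_def
proof (intro conjI)
  note e = exactD[OF assms]
  show "g \<in> Hom C Y Z" "h \<in> Hom C Z (ShO C X)" using e by blast+
  show "Neg C (ShA C f) \<in> Hom C (ShO C X) (ShO C Y)" using Neg_in_Hom ShA_in_Hom e(1) by blast
  show "(g, h, Neg C (ShA C f)) \<in> Dist C" using TR2 Dist_triangle e(4) by blast
qed

lemma exact_rotate_back:
  assumes "exact f g h X Y Z"
  obtains k where "exact k f g (shift C (-1) Z) X Y"
proof -
  note e = exactD[OF assms]
  let ?W = "shift C (-1) Z"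
  have W: "?W \<in> Obj C" "ShO C ?W = Z" using shift_in_Obj ShO_shift_minus_1 e(7) by blast+
  have "Neg C h \<in> Hom C (ShO C ?W) (ShO C X)" using Neg_in_Hom e(3) W by simp
  then obtain k where k: "k \<in> Hom C ?W X" "ShA C k = Neg C h"
    using ShA_surj W e(5) by blast
  have "triangle C k f g"
    using k(1) e W unfolding triangle_def by (auto simp: Hom_def)
  moreover have "(f, g, Neg C (ShA C k)) \<in> Dist C" using k(2) Neg_Neg e(3,4) by simp
  ultimately have "(k, f, g) \<in> Dist C" using TR2 by blast
  then have "exact k f g ?W X Y" unfolding exact_def using k(1) e W by simp
  then show ?thesis using that by blast
qed

text \<open>The pair \<open>(id, f)\<close> extends to a morphism to the given triangle from the triangle on the
  identity of \<open>X\<close>, whose third term is zero.\<close>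

lemma exact_Cmp_zero:
  assumes "exact f g h X Y Z"
  shows "g \<cdot> f = Zro C X Z"
proof -
  note e = exactD[OF assms]
  obtain N where N: "N \<in> zero_objects C" using zero_object_exists by blast
  then have NO: "N \<in> Obj C" using zero_object_Obj by blast
  have idX: "Idn C X \<in> Hom C X X" using Idn_in_Hom e(5) .
  have z: "Zro C X N \<in> Hom C X N" "Zro C N (ShO C X) \<in> Hom C N (ShO C X)"
    using Zro_in_Hom NO e(5) ShO_in_Obj by blast+
  have "f \<cdot> Idn C X = f \<cdot> Idn C X" ..
  then obtain c where
    "triangle_morphism C (Idn C X, Zro C X N, Zro C N (ShO C X)) (f, g, h) (Idn C X) f c"
    using TR3[OF TR1_id[OF e(5) N] e(4), of "Idn C X" f] idX e(1,2) z by (auto simp: Hom_def)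
  then have "c \<in> Hom C N Z" "c \<cdot> Zro C X N = g \<cdot> f"
    using z e(3) by (auto simp: triangle_morphism_def Hom_def)
  then show ?thesis using Cmp_Zro_right[OF _ e(5)] by metis
qed

lemma exact_objects_rotate: "exact_objects X Y Z \<Longrightarrow> exact_objects Y Z (ShO C X)"
  unfolding exact_objects_def using exact_rotate by blast

lemma exact_objects_rotate_back: "exact_objects X Y Z \<Longrightarrow> exact_objects (shift C (-1) Z) X Y"
  unfolding exact_objects_def using exact_rotate_back by metis

lemma exact_objects_Obj:
  "exact_objects X Y Z \<Longrightarrow> X \<in> Obj C \<and> Y \<in> Obj C \<and> Z \<in> Obj C"
  unfolding exact_objects_def using exactD(5-7) by blast

lemma exact_objects_shift:
  assumes "exact_objects X Y Z"
  shows "exact_objects (shift C n X) (shift C n Y) (shift C n Z)"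
proof (induction n rule: int_induct[where k = 0])
  case base
  show ?case using assms by (simp add: shift_0)
next
  case (step1 i)
  then show ?case
    using exact_objects_rotate exact_objects_Obj[OF assms] by (simp add: shift_Suc)
next
  case (step2 i)
  have "shift C (-1) (shift C i W) = shift C (i - 1) W" if "W \<in> Obj C" for W
    using shift_add[OF that, of "-1" i] by simp
  then show ?case
    using exact_objects_rotate_back[OF exact_objects_rotate_back[OF exact_objects_rotate_back[OF step2(2)]]]
      exact_objects_Obj[OF assms] by simp
qed

text \<open>The pair \<open>(u, 0)\<close> is a commuting square from the identity triangle of \<open>W\<close>, rotated once, to
  the given triangle, rotated once. The morphism that completes it to a morphism of triangles is
  the shift of the desired factorisation.\<close>

lemma exact_factor_left:
  assumes ex: "exact f g h X Y Z" and u: "u \<in> Hom C W Y" and gu: "g \<cdot> u = Zro C W Z"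
  obtains v where "v \<in> Hom C W X" "f \<cdot> v = u"
proof -
  note e = exactD[OF ex]
  have WO: "W \<in> Obj C" using Hom_objs u by blast
  obtain N where N: "N \<in> zero_objects C" using zero_object_exists by blast
  then have NO: "N \<in> Obj C" using zero_object_Obj by blast
  have idW: "Idn C W \<in> Hom C W W" using Idn_in_Hom WO .
  have e1: "exact (Idn C W) (Zro C W N) (Zro C N (ShO C W)) W W N"
    unfolding exact_def using TR1_id[OF WO N] idW Zro_in_Hom WO NO ShO_in_Obj by blast
  note r1 = exactD[OF exact_rotate[OF e1]] and r2 = exactD[OF exact_rotate[OF ex]]
  have z: "Zro C N Z \<in> Hom C N Z" using Zro_in_Hom NO e(7) .
  have comm: "Zro C N Z \<cdot> Zro C W N = g \<cdot> u"
    using gu Cmp_Zro_left[OF r1(1) e(7)] by simp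
  obtain c where c: "triangle_morphism C (Zro C W N, Zro C N (ShO C W), Neg C (ShA C (Idn C W)))
      (g, h, Neg C (ShA C f)) u (Zro C N Z) c"
    using TR3[OF r1(4) r2(4), of u "Zro C N Z"] u z comm r1(1-3) r2(1-3) by (auto simp: Hom_def)
  then have cH: "c \<in> Hom C (ShO C W) (ShO C X)"
    and eq: "ShA C u \<cdot> Neg C (ShA C (Idn C W)) = Neg C (ShA C f) \<cdot> c"
    using r1(1-3) r2(1-3) by (auto simp: triangle_morphism_def Hom_def)
  obtain v where v: "v \<in> Hom C W X" "ShA C v = c" using ShA_surj cH WO e(5) by blast
  have fv: "f \<cdot> v \<in> Hom C W Y" using Cmp_in_Hom e(1) v(1) .
  have "ShA C u \<cdot> Neg C (ShA C (Idn C W)) = Neg C (ShA C (u \<cdot> Idn C W))"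
    using Cmp_Neg[OF ShA_in_Hom[OF u] ShA_in_Hom[OF idW]] ShA_Cmp[OF u idW] by simp
  moreover have "Neg C (ShA C f) \<cdot> c = Neg C (ShA C (f \<cdot> v))"
    using Neg_Cmp[OF ShA_in_Hom[OF e(1)] cH] ShA_Cmp[OF e(1) v(1)] v(2) by simp
  ultimately have "Neg C (ShA C u) = Neg C (ShA C (f \<cdot> v))"
    using eq Cmp_Idn_right[OF u] by simp
  then have "ShA C u = ShA C (f \<cdot> v)"
    using Neg_Neg ShA_in_Hom u fv by metis
  then have "u = f \<cdot> v" using ShA_inject u fv by blast
  then show ?thesis using that v(1) by blast
qed

text \<open>Dually, the pair \<open>(0, u)\<close> maps the given triangle to a triangle \<open>0 \<rightarrow> W \<rightarrow> W \<rightarrow> 0\<close>, obtained by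
  rotating the identity triangle of \<open>W\<close> backwards.\<close>

lemma exact_factor_right:
  assumes ex: "exact f g h X Y Z" and u: "u \<in> Hom C Y W" and uf: "u \<cdot> f = Zro C X W"
  obtains v where "v \<in> Hom C Z W" "v \<cdot> g = u"
proof -
  note e = exactD[OF ex]
  have WO: "W \<in> Obj C" using Hom_objs u by blast
  obtain N where N: "N \<in> zero_objects C" using zero_object_exists by blast
  then have NO: "N \<in> Obj C" using zero_object_Obj by blast
  have "exact (Idn C W) (Zro C W N) (Zro C N (ShO C W)) W W N"
    unfolding exact_def
    using TR1_id[OF WO N] Idn_in_Hom[OF WO] Zro_in_Hom WO NO ShO_in_Obj by blast
  then obtain k where k: "exact k (Idn C W) (Zro C W N) (shift C (-1) N) W W"
    using exact_rotate_back by blast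
  note r = exactD[OF k]
  let ?z = "Zro C X (shift C (-1) N)"
  have z: "?z \<in> Hom C X (shift C (-1) N)" using Zro_in_Hom e(5) r(5) .
  have "Idn C W \<cdot> k = Zro C (shift C (-1) N) W"
  proof -
    have "ShA C k = Zro C (ShO C (shift C (-1) N)) (ShO C W)"
      using ShA_in_Hom[OF r(1)] orthogonalD[OF zero_object_orthogonal(1)[OF N]] ShO_in_Obj[OF WO]
        ShO_shift_minus_1[OF NO] by simp
    then have "k = Zro C (shift C (-1) N) W"
      using ShA_inject[OF r(1)] Zro_in_Hom ShA_Zro r(5) WO by simp
    then show ?thesis using Cmp_Idn_left[OF r(1)] by simp
  qed
  then have "k = Zro C (shift C (-1) N) W" using Cmp_Idn_left[OF r(1)] by simp
  then have comm: "u \<cdot> f = k \<cdot> ?z"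
    using uf Cmp_Zro_right[OF r(1) e(5)] by simp
  obtain c where c: "triangle_morphism C (f, g, h) (k, Idn C W, Zro C W N) ?z u c"
    using TR3[OF e(4) r(4), of ?z u] u z comm e(1-3) r(1-3) by (auto simp: Hom_def)
  then have "c \<in> Hom C Z W" "c \<cdot> g = Idn C W \<cdot> u"
    using e(1-3) r(1-3) by (auto simp: triangle_morphism_def Hom_def)
  then show ?thesis using that Cmp_Idn_left[OF u] by simp
qed

text \<open>The factorisations above are in general not unique; the difference of two of them factors
  through the preceding, respectively the following, term of the rotated triangle. An
  orthogonality hypothesis on that term restores uniqueness.\<close>

lemma exact_left_cancel:
  assumes ex: "exact f g h X Y Z" and o: "orthogonal W (shift C (-1) Z)"
    and v: "v \<in> Hom C W X" "w \<in> Hom C W X" "f \<cdot> v = f \<cdot> w"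
  shows "v = w"
proof -
  note e = exactD[OF ex]
  obtain k where k: "exact k f g (shift C (-1) Z) X Y" using exact_rotate_back ex by blast
  have d: "v \<oplus> Neg C w \<in> Hom C W X" using Add_in_Hom Neg_in_Hom v by blast
  obtain t where t: "t \<in> Hom C W (shift C (-1) Z)" "k \<cdot> t = v \<oplus> Neg C w"
    using exact_factor_left[OF k d Cmp_diff_right[OF e(1) v]] by blast
  have "v \<oplus> Neg C w = Zro C W X"
    using orthogonalD[OF o t(1)] t(2) Cmp_Zro_right[OF exactD(1)[OF k]] Hom_objs(1)[OF v(1)] by simp
  then show ?thesis using eq_if_diff_Zro v by blast
qed

lemma exact_right_cancel:
  assumes ex: "exact f g h X Y Z" and o: "orthogonal (ShO C X) W"
    and v: "v \<in> Hom C Z W" "w \<in> Hom C Z W" "v \<cdot> g = w \<cdot> g"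
  shows "v = w"
proof -
  note e = exactD[OF ex]
  have d: "v \<oplus> Neg C w \<in> Hom C Z W" using Add_in_Hom Neg_in_Hom v by blast
  obtain t where t: "t \<in> Hom C (ShO C X) W" "t \<cdot> h = v \<oplus> Neg C w"
    using exact_factor_right[OF exact_rotate[OF ex] d Cmp_diff_left[OF v(1,2) e(2) v(3)]] by blast
  have "v \<oplus> Neg C w = Zro C Z W"
    using orthogonalD[OF o t(1)] t(2) Cmp_Zro_left[OF e(3)] Hom_objs(2)[OF v(1)] by simp
  then show ?thesis using eq_if_diff_Zro v by blast
qed

lemma left_perp_extension:
  assumes "S \<subseteq> Obj C" "exact_objects X Y Z" "X \<in> left_perp S" "Z \<in> left_perp S"
  shows "Y \<in> left_perp S"
proof -
  obtain f g h where ex: "exact f g h X Y Z" using assms(2) unfolding exact_objects_def by blast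
  note e = exactD[OF ex]
  have "orthogonal Y W" if W: "W \<in> S" for W
  proof (rule orthogonalI)
    show WO: "Y \<in> Obj C" "W \<in> Obj C" using e W assms(1) by auto
    fix u assume u: "u \<in> Hom C Y W"
    have "u \<cdot> f = Zro C X W"
      using orthogonalD Cmp_in_Hom[OF u e(1)] assms(3) W unfolding left_perp_def by blast
    then obtain v where v: "v \<in> Hom C Z W" "v \<cdot> g = u" using exact_factor_right[OF ex u] by blast
    have "v = Zro C Z W" using orthogonalD v(1) assms(4) W unfolding left_perp_def by blast
    then show "u = Zro C Y W" using v(2) Cmp_Zro_left[OF e(2) WO(2)] by simp
  qed
  then show ?thesis using e(6) unfolding left_perp_def by blast
qed

lemma right_perp_extension:
  assumes "S \<subseteq> Obj C" "exact_objects X Y Z" "X \<in> right_perp S" "Z \<in> right_perp S"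
  shows "Y \<in> right_perp S"
proof -
  obtain f g h where ex: "exact f g h X Y Z" using assms(2) unfolding exact_objects_def by blast
  note e = exactD[OF ex]
  have "orthogonal W Y" if W: "W \<in> S" for W
  proof (rule orthogonalI)
    show WO: "Y \<in> Obj C" "W \<in> Obj C" using e W assms(1) by auto
    fix u assume u: "u \<in> Hom C W Y"
    have "g \<cdot> u = Zro C W Z"
      using orthogonalD Cmp_in_Hom[OF e(2) u] assms(4) W unfolding right_perp_def by blast
    then obtain v where v: "v \<in> Hom C W X" "f \<cdot> v = u" using exact_factor_left[OF ex u] by blast
    have "v = Zro C W X" using orthogonalD v(1) assms(3) W unfolding right_perp_def by blast
    then show "u = Zro C W Y" using v(2) Cmp_Zro_right[OF e(1) WO(2)] by simp
  qed
  then show ?thesis using e(6) unfolding right_perp_def by blast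
qed

text \<open>The vanishing hypotheses make the comparison morphisms between the outer terms of two
  triangles unique, so that going back and forth is the identity.\<close>

lemma exact_retract_first:
  assumes ex: "exact f g h X Y Z" and ex': "exact f' g' h' X' Y Z'"
    and o: "orthogonal X Z'" "orthogonal X' Z" "orthogonal X (shift C (-1) Z)"
  shows "retract X X'"
proof -
  note e = exactD[OF ex] and e' = exactD[OF ex']
  have "g' \<cdot> f = Zro C X Z'" using orthogonalD[OF o(1)] Cmp_in_Hom e'(2) e(1) by blast
  then obtain a where a: "a \<in> Hom C X X'" "f' \<cdot> a = f" using exact_factor_left[OF ex' e(1)] by blast
  have "g \<cdot> f' = Zro C X' Z" using orthogonalD[OF o(2)] Cmp_in_Hom e(2) e'(1) by blast
  then obtain b where b: "b \<in> Hom C X' X" "f \<cdot> b = f'" using exact_factor_left[OF ex e'(1)] by blast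
  have "f \<cdot> (b \<cdot> a) = f \<cdot> Idn C X"
    using Cmp_assoc[OF e(1) b(1) a(1)] a(2) b(2) Cmp_Idn_right[OF e(1)] by simp
  then have "b \<cdot> a = Idn C X"
    using exact_left_cancel[OF ex o(3) Cmp_in_Hom[OF b(1) a(1)] Idn_in_Hom[OF e(5)]] by blast
  then show ?thesis unfolding retract_def using a(1) b(1) by blast
qed

lemma exact_retract_third:
  assumes ex: "exact f g h X Y Z" and ex': "exact f' g' h' X' Y Z'"
    and o: "orthogonal X Z'" "orthogonal X' Z" "orthogonal (ShO C X) Z"
  shows "retract Z Z'"
proof -
  note e = exactD[OF ex] and e' = exactD[OF ex']
  have "g' \<cdot> f = Zro C X Z'" using orthogonalD[OF o(1)] Cmp_in_Hom e'(2) e(1) by blast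
  then obtain a where a: "a \<in> Hom C Z Z'" "a \<cdot> g = g'" using exact_factor_right[OF ex e'(2)] by blast
  have "g \<cdot> f' = Zro C X' Z" using orthogonalD[OF o(2)] Cmp_in_Hom e(2) e'(1) by blast
  then obtain b where b: "b \<in> Hom C Z' Z" "b \<cdot> g' = g" using exact_factor_right[OF ex' e(2)] by blast
  have "(b \<cdot> a) \<cdot> g = Idn C Z \<cdot> g"
    using Cmp_assoc[OF b(1) a(1) e(2)] a(2) b(2) Cmp_Idn_left[OF e(2)] by simp
  then have "b \<cdot> a = Idn C Z"
    using exact_right_cancel[OF ex o(3) Cmp_in_Hom[OF b(1) a(1)] Idn_in_Hom[OF e(7)]] by blast
  then show ?thesis unfolding retract_def using a(1) b(1) by blast
qed

section \<open>Aisles and co-aisles as orthogonal classes\<close>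

lemma t_le_0: "t_le C E 0 = aisle E"
  by (auto simp: t_le_def shift_0)

lemma t_ge_0: "t_ge C E 0 = coaisle E"
  by (auto simp: t_ge_def shift_0)

lemma t_structure_Obj:
  assumes "t_structure C E"
  shows "aisle E \<subseteq> Obj C" "coaisle E \<subseteq> Obj C"
  using assms by (simp_all add: t_structure_def full_subcategory_def)

lemma mem_shift_image:
  assumes "S \<subseteq> Obj C"
  shows "X \<in> shift C (- n) ` S \<longleftrightarrow> X \<in> Obj C \<and> shift C n X \<in> S"
proof
  assume "X \<in> shift C (- n) ` S"
  then obtain Y where Y: "Y \<in> S" "X = shift C (- n) Y" by blast
  then have "Y \<in> Obj C" using assms by blast
  then show "X \<in> Obj C \<and> shift C n X \<in> S"
    using Y shift_in_Obj shift_add[of Y n "- n"] by (simp add: shift_0)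
next
  assume X: "X \<in> Obj C \<and> shift C n X \<in> S"
  then have "X = shift C (- n) (shift C n X)" using shift_add[of X "- n" n] by (simp add: shift_0)
  then show "X \<in> shift C (- n) ` S" using X image_eqI[of X "shift C (- n)" "shift C n X" S] by simp
qed

lemma t_le_iff:
  "t_structure C E \<Longrightarrow> X \<in> t_le C E n \<longleftrightarrow> X \<in> Obj C \<and> shift C n X \<in> aisle E"
  unfolding t_le_def by (rule mem_shift_image[OF t_structure_Obj(1)])

lemma t_ge_iff:
  "t_structure C E \<Longrightarrow> X \<in> t_ge C E n \<longleftrightarrow> X \<in> Obj C \<and> shift C n X \<in> coaisle E"
  unfolding t_ge_def by (rule mem_shift_image[OF t_structure_Obj(2)])

lemma t_le_Obj: "t_structure C E \<Longrightarrow> t_le C E n \<subseteq> Obj C"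
  by (auto simp: t_le_iff)

lemma t_ge_Obj: "t_structure C E \<Longrightarrow> t_ge C E n \<subseteq> Obj C"
  by (auto simp: t_ge_iff)

lemma t_le_shift:
  assumes "t_structure C E" "X \<in> Obj C"
  shows "shift C k X \<in> t_le C E n \<longleftrightarrow> X \<in> t_le C E (n + k)"
  using assms by (simp add: t_le_iff shift_in_Obj shift_add)

lemma t_ge_shift:
  assumes "t_structure C E" "X \<in> Obj C"
  shows "shift C k X \<in> t_ge C E n \<longleftrightarrow> X \<in> t_ge C E (n + k)"
  using assms by (simp add: t_ge_iff shift_in_Obj shift_add)

lemma t_le_subset_shift:
  assumes E: "t_structure C E" and F: "t_structure C F" and sub: "t_le C E a \<subseteq> t_le C F b"
  shows "t_le C E (a + k) \<subseteq> t_le C F (b + k)"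
proof
  fix X assume X: "X \<in> t_le C E (a + k)"
  then have XO: "X \<in> Obj C" using t_le_Obj[OF E] by blast
  then have "shift C k X \<in> t_le C F b" using X sub t_le_shift[OF E XO] by blast
  then show "X \<in> t_le C F (b + k)" using t_le_shift[OF F XO] by blast
qed

lemma t_ge_subset_shift:
  assumes E: "t_structure C E" and F: "t_structure C F" and sub: "t_ge C E a \<subseteq> t_ge C F b"
  shows "t_ge C E (a + k) \<subseteq> t_ge C F (b + k)"
proof
  fix X assume X: "X \<in> t_ge C E (a + k)"
  then have XO: "X \<in> Obj C" using t_ge_Obj[OF E] by blast
  then have "shift C k X \<in> t_ge C F b" using X sub t_ge_shift[OF E XO] by blast
  then show "X \<in> t_ge C F (b + k)" using t_ge_shift[OF F XO] by blast
qed

lemma t_le_mono: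
  assumes E: "t_structure C E" and "m \<le> n"
  shows "t_le C E m \<subseteq> t_le C E n"
  using assms(2)
proof (induction n rule: int_ge_induct)
  case (step i)
  have "t_le C E 0 \<subseteq> t_le C E 1" using E by (simp add: t_structure_def)
  then have "t_le C E (0 + i) \<subseteq> t_le C E (1 + i)" using t_le_subset_shift[OF E E] by blast
  then show ?case using step by (simp add: add.commute)
qed simp

lemma t_ge_mono:
  assumes E: "t_structure C E" and "m \<le> n"
  shows "t_ge C E n \<subseteq> t_ge C E m"
  using assms(2)
proof (induction n rule: int_ge_induct)
  case (step i)
  have "t_ge C E 1 \<subseteq> t_ge C E 0" using E by (simp add: t_structure_def)
  then have "t_ge C E (1 + i) \<subseteq> t_ge C E (0 + i)" using t_ge_subset_shift[OF E E] by blast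
  then show ?case using step by (simp add: add.commute)
qed simp

lemma orthogonal_le_ge:
  assumes E: "t_structure C E" and X: "X \<in> t_le C E m" and Y: "Y \<in> t_ge C E n" and "m < n"
  shows "orthogonal X Y"
proof -
  have XO: "X \<in> Obj C" and YO: "Y \<in> Obj C" using X Y t_le_Obj[OF E] t_ge_Obj[OF E] by blast+
  have "Y \<in> t_ge C E (1 + m)" using Y t_ge_mono[OF E, of "1 + m" n] \<open>m < n\<close> by auto
  then have "shift C m Y \<in> t_ge C E 1" using t_ge_shift[OF E YO] by blast
  moreover have "shift C m X \<in> t_le C E 0" using X t_le_shift[OF E XO, of m 0] by simp
  ultimately have "orthogonal (shift C m X) (shift C m Y)"
    using E by (simp add: t_structure_def orthogonal_def)
  then show ?thesis using orthogonal_shift[OF XO YO] by blast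
qed

lemma truncation_triangle_iff:
  "truncation_triangle C E n A X B \<longleftrightarrow>
     A \<in> t_le C E n \<and> B \<in> t_ge C E (n + 1) \<and> exact_objects A X B"
  unfolding truncation_triangle_def exact_objects_def exact_def by blast

lemma truncation_exists:
  assumes E: "t_structure C E" and X: "X \<in> Obj C"
  shows "\<exists>A B. truncation_triangle C E n A X B"
proof -
  obtain A B where AB: "A \<in> t_le C E 0" "B \<in> t_ge C E 1" "exact_objects A (shift C n X) B"
    using E shift_in_Obj[OF X, of n] by (auto simp: t_structure_def truncation_triangle_iff)
  then have O: "A \<in> Obj C" "B \<in> Obj C" using exact_objects_Obj by blast+
  have "shift C (- n) (shift C n X) = X" using shift_add[OF X, of "- n" n] by (simp add: shift_0)
  then have "exact_objects (shift C (- n) A) X (shift C (- n) B)"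
    using exact_objects_shift[OF AB(3), of "- n"] by simp
  moreover have "shift C (- n) A \<in> t_le C E n" "shift C (- n) B \<in> t_ge C E (n + 1)"
    using AB(1,2) t_le_shift[OF E O(1)] t_ge_shift[OF E O(2)] by simp_all
  ultimately show ?thesis unfolding truncation_triangle_iff by blast
qed

text \<open>If \<open>X\<close> is orthogonal to \<open>E\<^sup>\<ge>\<^sup>1\<close>, its map to the truncation in \<open>E\<^sup>\<ge>\<^sup>1\<close> vanishes, so the identity of
  \<open>X\<close> factors through the other truncation, which is thereby isomorphic to \<open>X\<close>. The aisle is
  closed under isomorphisms.\<close>

lemma aisle_eq_left_perp:
  assumes E: "t_structure C E"
  shows "aisle E = left_perp (t_ge C E 1)"
proof
  show "aisle E \<subseteq> left_perp (t_ge C E 1)"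
    using orthogonal_le_ge[OF E, of _ 0 _ 1] t_structure_Obj(1)[OF E]
    unfolding left_perp_def t_le_0 by auto
  show "left_perp (t_ge C E 1) \<subseteq> aisle E"
  proof
    fix X assume X: "X \<in> left_perp (t_ge C E 1)"
    then have XO: "X \<in> Obj C" unfolding left_perp_def by blast
    obtain A B where "truncation_triangle C E 0 A X B" using truncation_exists[OF E XO] by blast
    then have A: "A \<in> t_le C E 0" and B: "B \<in> t_ge C E 1" and "exact_objects A X B"
      by (simp_all add: truncation_triangle_iff)
    then obtain f g h where ex: "exact f g h A X B" unfolding exact_objects_def by blast
    note e = exactD[OF ex]
    have "g = Zro C X B" using orthogonalD e(2) X B unfolding left_perp_def by blast
    then have "g \<cdot> Idn C X = Zro C X B" using Cmp_Idn_right[OF e(2)] by simp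
    then obtain v where v: "v \<in> Hom C X A" "f \<cdot> v = Idn C X"
      using exact_factor_left[OF ex Idn_in_Hom[OF XO]] by blast
    have "shift C (-1) B \<in> t_ge C E 2" using B t_ge_shift[OF E e(7), of "-1" 2] by simp
    then have o: "orthogonal A (shift C (-1) B)" using orthogonal_le_ge[OF E A, of _ 2] by simp
    have "f \<cdot> (v \<cdot> f) = f \<cdot> Idn C A"
      using Cmp_assoc[OF e(1) v(1) e(1)] v(2) Cmp_Idn_left[OF e(1)] Cmp_Idn_right[OF e(1)] by simp
    then have "v \<cdot> f = Idn C A"
      using exact_left_cancel[OF ex o Cmp_in_Hom[OF v(1) e(1)] Idn_in_Hom[OF e(5)]] by blast
    then have "is_iso C f" using e(1) v unfolding is_iso_def by (auto simp: Hom_def)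
    then have "isomorphic C A X" using e(1) unfolding isomorphic_def by blast
    then show "X \<in> aisle E"
      using E A XO by (simp add: t_structure_def full_subcategory_def t_le_0)
  qed
qed

text \<open>The dual argument uses the truncation triangle at \<open>-1\<close>, whose third term lies in the co-aisle
  itself and not in a shift of it.\<close>

lemma coaisle_eq_right_perp:
  assumes E: "t_structure C E"
  shows "coaisle E = right_perp (t_le C E (-1))"
proof
  show "coaisle E \<subseteq> right_perp (t_le C E (-1))"
    using orthogonal_le_ge[OF E, of _ "-1" _ 0] t_structure_Obj(2)[OF E]
    unfolding right_perp_def t_ge_0 by auto
  show "right_perp (t_le C E (-1)) \<subseteq> coaisle E"
  proof
    fix X assume X: "X \<in> right_perp (t_le C E (-1))"
    then have XO: "X \<in> Obj C" unfolding right_perp_def by blast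
    obtain A B where "truncation_triangle C E (-1) A X B" using truncation_exists[OF E XO] by blast
    then have A: "A \<in> t_le C E (-1)" and B: "B \<in> t_ge C E 0" and "exact_objects A X B"
      by (simp_all add: truncation_triangle_iff)
    then obtain f g h where ex: "exact f g h A X B" unfolding exact_objects_def by blast
    note e = exactD[OF ex]
    have "f = Zro C A X" using orthogonalD e(1) X A unfolding right_perp_def by blast
    then have "Idn C X \<cdot> f = Zro C A X" using Cmp_Idn_left[OF e(1)] by simp
    then obtain v where v: "v \<in> Hom C B X" "v \<cdot> g = Idn C X"
      using exact_factor_right[OF ex Idn_in_Hom[OF XO]] by blast
    have "ShO C A \<in> t_le C E (-2)" using A t_le_shift[OF E e(5), of 1 "-2"] shift_1[OF e(5)] by simp
    then have o: "orthogonal (ShO C A) B" using orthogonal_le_ge[OF E _ B] by fastforce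
    have "(g \<cdot> v) \<cdot> g = Idn C B \<cdot> g"
      using Cmp_assoc[OF e(2) v(1) e(2)] v(2) Cmp_Idn_left[OF e(2)] Cmp_Idn_right[OF e(2)] by simp
    then have "g \<cdot> v = Idn C B"
      using exact_right_cancel[OF ex o Cmp_in_Hom[OF e(2) v(1)] Idn_in_Hom[OF e(7)]] by blast
    then have "is_iso C v" using e(2) v unfolding is_iso_def by (auto simp: Hom_def)
    then have "isomorphic C B X" using v(1) unfolding isomorphic_def by blast
    then show "X \<in> coaisle E"
      using E B XO by (simp add: t_structure_def full_subcategory_def t_ge_0)
  qed
qed

lemma t_le_eq_left_perp:
  assumes E: "t_structure C E"
  shows "t_le C E n = left_perp (t_ge C E (n + 1))"
proof
  show "t_le C E n \<subseteq> left_perp (t_ge C E (n + 1))"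
    using orthogonal_le_ge[OF E, of _ n _ "n + 1"] t_le_Obj[OF E] unfolding left_perp_def by auto
  show "left_perp (t_ge C E (n + 1)) \<subseteq> t_le C E n"
  proof
    fix X assume X: "X \<in> left_perp (t_ge C E (n + 1))"
    then have XO: "X \<in> Obj C" unfolding left_perp_def by blast
    have "orthogonal (shift C n X) Y" if Y: "Y \<in> t_ge C E 1" for Y
    proof -
      have YO: "Y \<in> Obj C" using Y t_ge_Obj[OF E] by blast
      have "shift C (- n) Y \<in> t_ge C E (n + 1)" using Y t_ge_shift[OF E YO] by simp
      then have "orthogonal X (shift C (- n) Y)" using X unfolding left_perp_def by blast
      moreover have "shift C n (shift C (- n) Y) = Y"
        using shift_add[OF YO, of n "- n"] by (simp add: shift_0)
      ultimately show ?thesis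
        using orthogonal_shift[OF XO shift_in_Obj[OF YO, of "- n"], of n] by simp
    qed
    then have "shift C n X \<in> aisle E"
      unfolding aisle_eq_left_perp[OF E] left_perp_def using shift_in_Obj XO by blast
    then show "X \<in> t_le C E n" using t_le_iff[OF E] XO by blast
  qed
qed

lemma t_ge_eq_right_perp:
  assumes E: "t_structure C E"
  shows "t_ge C E n = right_perp (t_le C E (n - 1))"
proof
  show "t_ge C E n \<subseteq> right_perp (t_le C E (n - 1))"
    using orthogonal_le_ge[OF E, of _ "n - 1" _ n] t_ge_Obj[OF E] unfolding right_perp_def by auto
  show "right_perp (t_le C E (n - 1)) \<subseteq> t_ge C E n"
  proof
    fix X assume X: "X \<in> right_perp (t_le C E (n - 1))"
    then have XO: "X \<in> Obj C" unfolding right_perp_def by blast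
    have "orthogonal Y (shift C n X)" if Y: "Y \<in> t_le C E (-1)" for Y
    proof -
      have YO: "Y \<in> Obj C" using Y t_le_Obj[OF E] by blast
      have "shift C (- n) Y \<in> t_le C E (n - 1)" using Y t_le_shift[OF E YO] by simp
      then have "orthogonal (shift C (- n) Y) X" using X unfolding right_perp_def by blast
      moreover have "shift C n (shift C (- n) Y) = Y"
        using shift_add[OF YO, of n "- n"] by (simp add: shift_0)
      ultimately show ?thesis
        using orthogonal_shift[OF shift_in_Obj[OF YO, of "- n"] XO, of n] by simp
    qed
    then have "shift C n X \<in> coaisle E"
      unfolding coaisle_eq_right_perp[OF E] right_perp_def using shift_in_Obj XO by blast
    then show "X \<in> t_ge C E n" using t_ge_iff[OF E] XO by blast
  qed
qed

lemma t_le_subset_iff: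
  assumes E: "t_structure C E" and F: "t_structure C F"
  shows "t_le C E a \<subseteq> t_le C F b \<longleftrightarrow> t_ge C F (b + 1) \<subseteq> t_ge C E (a + 1)"
proof
  assume "t_le C E a \<subseteq> t_le C F b"
  then show "t_ge C F (b + 1) \<subseteq> t_ge C E (a + 1)"
    using t_ge_eq_right_perp[OF E, of "a + 1"] t_ge_eq_right_perp[OF F, of "b + 1"]
    by (auto simp: right_perp_def)
next
  assume "t_ge C F (b + 1) \<subseteq> t_ge C E (a + 1)"
  then show "t_le C E a \<subseteq> t_le C F b"
    unfolding t_le_eq_left_perp[OF E] t_le_eq_left_perp[OF F] by (auto simp: left_perp_def)
qed

lemma t_le_subset_iff_t_ge:
  assumes E: "t_structure C E" and F: "t_structure C F"
  shows "t_le C E a \<subseteq> t_le C F b \<longleftrightarrow> t_ge C F b \<subseteq> t_ge C E a"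
  using t_le_subset_iff[OF E F] t_ge_subset_shift[OF F E, of b a 1]
    t_ge_subset_shift[OF F E, of "b + 1" "a + 1" "-1"] by auto

lemma coaisle_determines_t_structure:
  assumes "t_structure C E" "t_structure C F" "coaisle E = coaisle F"
  shows "E = F"
proof (rule prod_eqI)
  show "aisle E = aisle F"
    using aisle_eq_left_perp assms unfolding t_ge_def by metis
qed (fact assms(3))

lemma additive_class_t_le:
  assumes "t_structure C E"
  shows "additive_class (t_le C E n)"
  using additive_class_left_perp t_ge_Obj[OF assms] t_le_eq_left_perp[OF assms] by simp

lemma additive_class_t_ge:
  assumes "t_structure C E"
  shows "additive_class (t_ge C E n)"
  using additive_class_right_perp t_le_Obj[OF assms] t_ge_eq_right_perp[OF assms] by simp

lemma t_le_zero:
  assumes "t_structure C E" "X \<in> zero_objects C"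
  shows "X \<in> t_le C E n"
  by (rule subsetD[OF additive_classD(2)[OF additive_class_t_le[OF assms(1)]] assms(2)])

lemma t_le_retract:
  assumes "t_structure C E" "retract X Y" "Y \<in> t_le C E n"
  shows "X \<in> t_le C E n"
  by (rule additive_classD(3)[OF additive_class_t_le[OF assms(1)] assms(2,3)])

lemma t_ge_zero:
  assumes "t_structure C E" "X \<in> zero_objects C"
  shows "X \<in> t_ge C E n"
  by (rule subsetD[OF additive_classD(2)[OF additive_class_t_ge[OF assms(1)]] assms(2)])

lemma t_ge_retract:
  assumes "t_structure C E" "retract X Y" "Y \<in> t_ge C E n"
  shows "X \<in> t_ge C E n"
  by (rule additive_classD(3)[OF additive_class_t_ge[OF assms(1)] assms(2,3)])

lemma zero_if_le_ge:
  assumes "t_structure C E" "X \<in> t_le C E m" "X \<in> t_ge C E n" "m < n"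
  shows "X \<in> zero_objects C"
  by (rule zero_object_if_self_orthogonal[OF subsetD[OF t_le_Obj[OF assms(1)] assms(2)]
        orthogonal_le_ge[OF assms]])

lemma t_le_extension:
  assumes "t_structure C E" "exact_objects X Y Z" "X \<in> t_le C E n" "Z \<in> t_le C E n"
  shows "Y \<in> t_le C E n"
  using left_perp_extension[OF t_ge_Obj assms(2)] assms t_le_eq_left_perp[OF assms(1)] by simp

lemma t_ge_extension:
  assumes "t_structure C E" "exact_objects X Y Z" "X \<in> t_ge C E n" "Z \<in> t_ge C E n"
  shows "Y \<in> t_ge C E n"
  using right_perp_extension[OF t_le_Obj assms(2)] assms t_ge_eq_right_perp[OF assms(1)] by simp

lemma t_le_cone:
  assumes E: "t_structure C E" and ex: "exact_objects X Y Z"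
    and "X \<in> t_le C E (n + 1)" "Y \<in> t_le C E n"
  shows "Z \<in> t_le C E n"
proof -
  have XO: "X \<in> Obj C" using exact_objects_Obj[OF ex] by blast
  have "ShO C X \<in> t_le C E n" using t_le_shift[OF E XO, of 1 n] shift_1[OF XO] assms(3) by simp
  then show ?thesis using t_le_extension[OF E exact_objects_rotate[OF ex]] assms(4) by blast
qed

lemma t_ge_cocone:
  assumes E: "t_structure C E" and ex: "exact_objects X Y Z"
    and "Y \<in> t_ge C E n" "Z \<in> t_ge C E (n - 1)"
  shows "X \<in> t_ge C E n"
proof -
  have ZO: "Z \<in> Obj C" using exact_objects_Obj[OF ex] by blast
  have "shift C (-1) Z \<in> t_ge C E n" using t_ge_shift[OF E ZO, of "-1" n] assms(4) by simp
  then show ?thesis using t_ge_extension[OF E exact_objects_rotate_back[OF ex]] assms(3) by blast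
qed

section \<open>Cohomology\<close>

lemma cohomology_triangles:
  assumes E: "t_structure C E" and X: "X \<in> Obj C"
  obtains A B A' where "A \<in> t_le C E 0" "B \<in> t_ge C E 1" "exact_objects A (shift C i X) B"
    "A' \<in> t_le C E (-1)" "cohomology C E i X \<in> t_ge C E 0" "exact_objects A' A (cohomology C E i X)"
proof -
  define A where "A = trunc_le C E 0 (shift C i X)"
  have "\<exists>B. truncation_triangle C E 0 A (shift C i X) B"
    unfolding A_def trunc_le_def by (rule someI_ex) (rule truncation_exists[OF E shift_in_Obj[OF X]])
  then obtain B where B: "A \<in> t_le C E 0" "B \<in> t_ge C E 1" "exact_objects A (shift C i X) B"
    by (auto simp: truncation_triangle_iff)
  then have AO: "A \<in> Obj C" using exact_objects_Obj by blast
  have "\<exists>B A'. truncation_triangle C E (0 - 1) A' A B" using truncation_exists[OF E AO] by blast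
  then have "\<exists>A'. truncation_triangle C E (0 - 1) A' A (trunc_ge C E 0 A)"
    unfolding trunc_ge_def by (rule someI_ex)
  then have "\<exists>A'. truncation_triangle C E (-1) A' A (cohomology C E i X)"
    by (simp add: cohomology_def A_def)
  then obtain A' where "A' \<in> t_le C E (-1)" "cohomology C E i X \<in> t_ge C E 0"
    "exact_objects A' A (cohomology C E i X)"
    by (auto simp: truncation_triangle_iff)
  with B show ?thesis using that by blast
qed

text \<open>By definition \<open>H\<^sup>i X\<close> is the truncation in \<open>E\<^sup>\<ge>\<^sup>0\<close> of an object \<open>A\<close> of \<open>E\<^sup>\<le>\<^sup>0\<close>; so its vanishing means
  that \<open>A\<close> lies already in \<open>E\<^sup>\<le>\<^sup>-\<^sup>1\<close>. Stated in this form it applies whatever choices the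
  truncations involve.\<close>

lemma truncation_zero_iff:
  assumes E: "t_structure C E" and ex: "exact_objects A' A H"
    and A': "A' \<in> t_le C E (-1)" and H: "H \<in> t_ge C E 0"
  shows "H \<in> zero_objects C \<longleftrightarrow> A \<in> t_le C E (-1)"
proof
  assume "H \<in> zero_objects C"
  then show "A \<in> t_le C E (-1)" using t_le_extension[OF E ex A'] t_le_zero[OF E] by blast
next
  assume "A \<in> t_le C E (-1)"
  moreover have "A' \<in> t_le C E (-1 + 1)" using A' t_le_mono[OF E, of "-1" 0] by auto
  ultimately have "H \<in> t_le C E (-1)" using t_le_cone[OF E ex, of "-1"] by blast
  then show "H \<in> zero_objects C" using zero_if_le_ge[OF E _ H, of "-1"] by simp
qed

lemma cohomology_zero_if_t_le:
  assumes E: "t_structure C E" and X: "X \<in> t_le C E k" and "k < i"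
  shows "cohomology C E i X \<in> zero_objects C"
proof -
  have XO: "X \<in> Obj C" using X t_le_Obj[OF E] by blast
  obtain A B A' where t: "A \<in> t_le C E 0" "B \<in> t_ge C E 1" "exact_objects A (shift C i X) B"
    "A' \<in> t_le C E (-1)" "cohomology C E i X \<in> t_ge C E 0" "exact_objects A' A (cohomology C E i X)"
    using cohomology_triangles[OF E XO] by metis
  have "X \<in> t_le C E (-1 + i)" using X t_le_mono[OF E, of k "-1 + i"] \<open>k < i\<close> by auto
  then have Xi: "shift C i X \<in> t_le C E (-1)" using t_le_shift[OF E XO] by blast
  have "A \<in> t_le C E (-1 + 1)" using t(1) by simp
  then have "B \<in> t_le C E (-1)" using t_le_cone[OF E t(3) _ Xi] by blast
  then have B: "B \<in> zero_objects C" using zero_if_le_ge[OF E _ t(2), of "-1"] by simp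
  have "exact_objects (shift C (-1) B) A (shift C i X)" using exact_objects_rotate_back[OF t(3)] .
  moreover have "shift C (-1) B \<in> t_le C E (-1)"
    using t_le_zero[OF E B] t_le_shift[OF E zero_object_Obj[OF B]] by blast
  ultimately have "A \<in> t_le C E (-1)" using t_le_extension[OF E _ _ Xi] by blast
  then show ?thesis using truncation_zero_iff[OF E t(6,4,5)] by blast
qed

lemma cohomology_zero_if_t_ge:
  assumes E: "t_structure C E" and X: "X \<in> t_ge C E k" and "i < k"
  shows "cohomology C E i X \<in> zero_objects C"
proof -
  have XO: "X \<in> Obj C" using X t_ge_Obj[OF E] by blast
  obtain A B A' where t: "A \<in> t_le C E 0" "B \<in> t_ge C E 1" "exact_objects A (shift C i X) B"
    "A' \<in> t_le C E (-1)" "cohomology C E i X \<in> t_ge C E 0" "exact_objects A' A (cohomology C E i X)"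
    using cohomology_triangles[OF E XO] by metis
  have "X \<in> t_ge C E (1 + i)" using X t_ge_mono[OF E, of "1 + i" k] \<open>i < k\<close> by auto
  then have "shift C i X \<in> t_ge C E 1" using t_ge_shift[OF E XO] by blast
  moreover have "B \<in> t_ge C E (1 - 1)" using t(2) t_ge_mono[OF E, of 0 1] by auto
  ultimately have "A \<in> t_ge C E 1" using t_ge_cocone[OF E t(3)] by blast
  then have "A \<in> zero_objects C" using zero_if_le_ge[OF E t(1)] by fastforce
  then show ?thesis using truncation_zero_iff[OF E t(6,4,5)] t_le_zero[OF E] by blast
qed

text \<open>Let \<open>A \<rightarrow> X \<rightarrow> B\<close> be the truncation triangle at \<open>k\<close>. Vanishing of the cohomology in degree
  \<open>n > k\<close> makes the truncations at \<open>n - 1\<close> and \<open>n\<close> agree, so that \<open>B\<close> lies deeper and deeper in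
  the co-aisle; non-degeneracy forces \<open>B = 0\<close>.\<close>

lemma t_le_if_cohomology_zero:
  assumes E: "t_structure C E" and XO: "X \<in> Obj C"
    and H: "\<And>i. k < i \<Longrightarrow> cohomology C E i X \<in> zero_objects C"
  shows "X \<in> t_le C E k"
proof -
  obtain A B where A: "A \<in> t_le C E k" and B: "B \<in> t_ge C E (k + 1)" and ex: "exact_objects A X B"
    using truncation_exists[OF E XO] unfolding truncation_triangle_iff by blast
  have AO: "A \<in> Obj C" and BO: "B \<in> Obj C" using exact_objects_Obj[OF ex] by blast+
  have deep: "B \<in> t_ge C E n" if "k + 1 \<le> n" for n
    using that
  proof (induction n rule: int_ge_induct)
    case base
    show ?case using B .
  next
    case (step n)
    obtain A1 B1 A1' where t: "A1 \<in> t_le C E 0" "B1 \<in> t_ge C E 1" "exact_objects A1 (shift C n X) B1"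
      "A1' \<in> t_le C E (-1)" "cohomology C E n X \<in> t_ge C E 0" "exact_objects A1' A1 (cohomology C E n X)"
      using cohomology_triangles[OF E XO] by metis
    have "k < n" using step(1) by simp
    then have A1: "A1 \<in> t_le C E (-1)" using truncation_zero_iff[OF E t(6,4,5)] H by blast
    have "A \<in> t_le C E (-1 + n)" using A t_le_mono[OF E, of k "-1 + n"] step(1) by auto
    then have An: "shift C n A \<in> t_le C E (-1)" using t_le_shift[OF E AO] by blast
    have Bn: "shift C n B \<in> t_ge C E 0" using t_ge_shift[OF E BO, of n 0] step by simp
    have "A \<in> t_le C E (-1 + (1 + n))" using A t_le_mono[OF E, of k "-1 + (1 + n)"] step(1) by auto
    then have "shift C (1 + n) A \<in> t_le C E (-1)" using t_le_shift[OF E AO] by blast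
    then have An1: "ShO C (shift C n A) \<in> t_le C E (-1)"
      using shift_Suc[OF AO, of n] by (simp add: add.commute)
    obtain f g h f' g' h' where
      e: "exact f g h (shift C n A) (shift C n X) (shift C n B)" "exact f' g' h' A1 (shift C n X) B1"
      using exact_objects_shift[OF ex, of n] t(3) unfolding exact_objects_def by blast
    have "retract (shift C n B) B1"
      by (rule exact_retract_third[OF e orthogonal_le_ge[OF E An t(2)]
            orthogonal_le_ge[OF E A1 Bn] orthogonal_le_ge[OF E An1 Bn]]) simp_all
    then have "shift C n B \<in> t_ge C E 1" using t_ge_retract[OF E _ t(2)] by blast
    then show ?case using t_ge_shift[OF E BO, of n 1] by (simp add: add.commute)
  qed
  have "B \<in> t_ge C E n" for n
    using deep[of "max n (k + 1)"] t_ge_mono[OF E, of n "max n (k + 1)"] by auto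
  then have "B \<in> (\<Inter>i. t_ge C E i)" by blast
  moreover have "(\<Inter>i. t_ge C E i) = zero_objects C" using E unfolding t_structure_def by simp
  ultimately have "B \<in> zero_objects C" by simp
  then show ?thesis using t_le_extension[OF E ex A] t_le_zero[OF E] by blast
qed

text \<open>Dually, the truncation of \<open>X\<close> in \<open>E\<^sup>\<le>\<^sup>k\<^sup>-\<^sup>1\<close> sinks into all \<open>E\<^sup>\<le>\<^sup>n\<close>.\<close>

lemma t_ge_if_cohomology_zero:
  assumes E: "t_structure C E" and XO: "X \<in> Obj C"
    and H: "\<And>i. i < k \<Longrightarrow> cohomology C E i X \<in> zero_objects C"
  shows "X \<in> t_ge C E k"
proof -
  obtain A B where "A \<in> t_le C E (k - 1)" "B \<in> t_ge C E (k - 1 + 1)" and ex: "exact_objects A X B"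
    using truncation_exists[OF E XO] unfolding truncation_triangle_iff by blast
  then have A: "A \<in> t_le C E (k - 1)" and B: "B \<in> t_ge C E k" by simp_all
  have AO: "A \<in> Obj C" and BO: "B \<in> Obj C" using exact_objects_Obj[OF ex] by blast+
  have deep: "A \<in> t_le C E n" if "n \<le> k - 1" for n
    using that
  proof (induction n rule: int_le_induct)
    case base
    show ?case using A .
  next
    case (step n)
    obtain A1 B1 A1' where t: "A1 \<in> t_le C E 0" "B1 \<in> t_ge C E 1" "exact_objects A1 (shift C n X) B1"
      "A1' \<in> t_le C E (-1)" "cohomology C E n X \<in> t_ge C E 0" "exact_objects A1' A1 (cohomology C E n X)"
      using cohomology_triangles[OF E XO] by metis
    have "n < k" using step(1) by simp
    then have A1: "A1 \<in> t_le C E (-1)" using truncation_zero_iff[OF E t(6,4,5)] H by blast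
    have An: "shift C n A \<in> t_le C E 0" using t_le_shift[OF E AO, of n 0] step by simp
    have "B \<in> t_ge C E (1 + n)" using B t_ge_mono[OF E, of "1 + n" k] step(1) by auto
    then have Bn: "shift C n B \<in> t_ge C E 1" using t_ge_shift[OF E BO] by blast
    have "shift C (-1) (shift C n B) \<in> t_ge C E 2"
      using Bn t_ge_shift[OF E shift_in_Obj[OF BO], of "-1" n 2] by simp
    then have Bn1: "shift C (-1) (shift C n B) \<in> t_ge C E 1" using t_ge_mono[OF E, of 1 2] by auto
    obtain f g h f' g' h' where
      e: "exact f g h (shift C n A) (shift C n X) (shift C n B)" "exact f' g' h' A1 (shift C n X) B1"
      using exact_objects_shift[OF ex, of n] t(3) unfolding exact_objects_def by blast
    have "retract (shift C n A) A1"
      by (rule exact_retract_first[OF e orthogonal_le_ge[OF E An t(2)]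
            orthogonal_le_ge[OF E A1 Bn] orthogonal_le_ge[OF E An Bn1]]) simp_all
    then have "shift C n A \<in> t_le C E (-1)" using t_le_retract[OF E _ A1] by blast
    then show ?case using t_le_shift[OF E AO, of n "-1"] by simp
  qed
  have "A \<in> t_le C E n" for n
    using deep[of "min n (k - 1)"] t_le_mono[OF E, of "min n (k - 1)" n] by auto
  then have "A \<in> (\<Inter>i. t_le C E i)" by blast
  moreover have "(\<Inter>i. t_le C E i) = zero_objects C" using E unfolding t_structure_def by simp
  ultimately have "A \<in> zero_objects C" by simp
  then show ?thesis using t_ge_extension[OF E ex _ B] t_ge_zero[OF E] by blast
qed

section \<open>Tilting\<close>

lemma Obj_heart: "Obj (heart C E) = t_le C E 0 \<inter> t_ge C E 0"
  by (simp add: heart_def full_subcat_simps t_le_0 t_ge_0)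

lemma additive_class_heart: "t_structure C E \<Longrightarrow> additive_class (t_le C E 0 \<inter> t_ge C E 0)"
  by (rule additive_class_Int[OF additive_class_t_le additive_class_t_ge])

text \<open>A morphism \<open>u\<close> from an object of the heart with \<open>g \<cdot> u = 0\<close> factors through \<open>f\<close>, and uniquely so
  because there are no nonzero morphisms from the heart to \<open>Z[-1]\<close>. Dually, there are none from
  \<open>X[1]\<close> to the heart.\<close>

lemma short_exact_heart:
  assumes E: "t_structure C E" and ex: "exact f g h X Y Z"
    and XH: "X \<in> Obj (heart C E)" and YH: "Y \<in> Obj (heart C E)" and ZH: "Z \<in> Obj (heart C E)"
  shows "short_exact (heart C E) f g"
proof -
  let ?A = "heart C E"
  note simps = Hom_full_subcat full_subcat_simps full_subcat_preadditive_simps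
  have hom: "u \<in> Hom ?A V W \<longleftrightarrow> u \<in> Hom C V W \<and> V \<in> Obj ?A \<and> W \<in> Obj ?A" for u V W
    by (simp add: heart_def simps)
  have arr: "u \<in> Hom C (Dom C u) (Cod C u) \<and> Dom C u \<in> Obj ?A \<and> Cod C u \<in> Obj ?A"
    if "u \<in> Arr ?A" for u
    using that by (simp add: heart_def simps Hom_def)
  have same: "Dom ?A = Dom C" "Cod ?A = Cod C" "Cmp ?A = Cmp C" "Zro ?A = Zro C"
    by (simp_all add: heart_def simps)
  note e = exactD[OF ex]
  have dc: "Dom C f = X" "Cod C f = Y" "Dom C g = Y" "Cod C g = Z" using e(1,2) by (auto simp: Hom_def)
  have fg: "f \<in> Arr ?A" "g \<in> Arr ?A"
    using e(1,2) XH YH ZH dc by (auto simp: heart_def simps Hom_def)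
  have "Z \<in> t_ge C E 0" "X \<in> t_le C E 0" using XH ZH by (simp_all add: Obj_heart)
  then have Z1: "shift C (-1) Z \<in> t_ge C E 1" and X1: "ShO C X \<in> t_le C E (-1)"
    using t_ge_shift[OF E e(7), of "-1" 1] t_le_shift[OF E e(5), of 1 "-1"] shift_1[OF e(5)] by simp_all
  have o: "orthogonal W (shift C (-1) Z)" "orthogonal (ShO C X) W" if "W \<in> Obj ?A" for W
    using that orthogonal_le_ge[OF E _ Z1, of W 0] orthogonal_le_ge[OF E X1, of W 0]
    by (simp_all add: Obj_heart)
  have gf: "g \<cdot> f = Zro C X Z" by (rule exact_Cmp_zero[OF ex])
  have "is_kernel ?A f g"
    unfolding is_kernel_def same dc
  proof (intro conjI ballI impI fg gf refl)
    fix u assume u: "u \<in> Arr ?A" and gu: "Cod C u = Y \<and> g \<cdot> u = Zro C (Dom C u) Z"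
    have uH: "u \<in> Hom C (Dom C u) Y" and W: "Dom C u \<in> Obj ?A" using arr[OF u] gu by auto
    obtain l where l: "l \<in> Hom C (Dom C u) X" "f \<cdot> l = u"
      using exact_factor_left[OF ex uH] gu by blast
    show "\<exists>!l. l \<in> Hom ?A (Dom C u) X \<and> f \<cdot> l = u"
    proof (rule ex1I[of _ l])
      show "l \<in> Hom ?A (Dom C u) X \<and> f \<cdot> l = u" using l W XH hom by simp
      fix l' assume "l' \<in> Hom ?A (Dom C u) X \<and> f \<cdot> l' = u"
      then show "l' = l" using exact_left_cancel[OF ex o(1)[OF W], of l' l] l hom by simp
    qed
  qed
  moreover have "is_cokernel ?A g f"
    unfolding is_cokernel_def same dc
  proof (intro conjI ballI impI fg gf refl)
    fix u assume u: "u \<in> Arr ?A" and uf: "Dom C u = Y \<and> u \<cdot> f = Zro C X (Cod C u)"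
    have uH: "u \<in> Hom C Y (Cod C u)" and W: "Cod C u \<in> Obj ?A" using arr[OF u] uf by auto
    obtain l where l: "l \<in> Hom C Z (Cod C u)" "l \<cdot> g = u"
      using exact_factor_right[OF ex uH] uf by blast
    show "\<exists>!l. l \<in> Hom ?A Z (Cod C u) \<and> l \<cdot> g = u"
    proof (rule ex1I[of _ l])
      show "l \<in> Hom ?A Z (Cod C u) \<and> l \<cdot> g = u" using l W ZH hom by simp
      fix l' assume "l' \<in> Hom ?A Z (Cod C u) \<and> l' \<cdot> g = u"
      then show "l' = l" using exact_right_cancel[OF ex o(2)[OF W], of l' l] l hom by simp
    qed
  qed
  ultimately show ?thesis unfolding short_exact_def by blast
qed

text \<open>An object of \<open>E\<^sup>\<le>\<^sup>-\<^sup>1\<close> has zero cohomology in degree \<open>0\<close> and above, and the torsion class contains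
  the zero objects; vanishing above degree \<open>0\<close> is equivalent to lying in \<open>E\<^sup>\<le>\<^sup>0\<close>.\<close>

lemma tilt_bounds:
  assumes E: "t_structure C E" and XY: "torsion_pair (heart C E) \<X> \<Y>"
  shows "t_le C E (-1) \<subseteq> aisle (tilt C E \<X> \<Y>)" "aisle (tilt C E \<X> \<Y>) \<subseteq> t_le C E 0"
proof -
  let ?H = "t_le C E 0 \<inter> t_ge C E 0"
  have full: "full_subcategory (full_subcat C ?H) \<X>"
    using XY unfolding torsion_pair_def heart_def t_le_0 t_ge_0 by blast
  note H = additive_classD[OF additive_class_heart[OF E]]
  have zero: "Z \<in> \<X>" if "Z \<in> zero_objects C" for Z
    by (rule full_subcategory_contains_zero_objects[OF H(1,2) full that])
  have sub: "\<X> \<subseteq> ?H" using full unfolding full_subcategory_def by (simp add: full_subcat_simps)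
  show "t_le C E (-1) \<subseteq> aisle (tilt C E \<X> \<Y>)"
  proof
    fix X assume X: "X \<in> t_le C E (-1)"
    have "cohomology C E i X \<in> zero_objects C" if "0 \<le> i" for i
      using cohomology_zero_if_t_le[OF E X] that by simp
    then show "X \<in> aisle (tilt C E \<X> \<Y>)"
      using zero X t_le_Obj[OF E] unfolding tilt_def by auto
  qed
  show "aisle (tilt C E \<X> \<Y>) \<subseteq> t_le C E 0"
    using t_le_if_cohomology_zero[OF E] unfolding tilt_def by auto
qed

text \<open>For an object \<open>M\<close> of \<open>E\<^sup>\<le>\<^sup>0\<close>, the triangle \<open>\<tau>\<^sup>\<le>\<^sup>-\<^sup>1 M \<rightarrow> M \<rightarrow> H\<^sup>0 M\<close> has its first term in \<open>E\<^sup>\<le>\<^sup>-\<^sup>1 \<subseteq> F\<^sup>\<le>\<^sup>0\<close>,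
  so \<open>M\<close> and \<open>H\<^sup>0 M\<close> lie in the aisle of \<open>F\<close> together. For an object \<open>M\<close> of \<open>E\<^sup>\<ge>\<^sup>-\<^sup>1\<close>, the triangle
  \<open>H\<^sup>-\<^sup>1 M \<rightarrow> M[-1] \<rightarrow> \<tau>\<^sup>\<ge>\<^sup>1 (M[-1])\<close> has its third term in \<open>E\<^sup>\<ge>\<^sup>1 \<subseteq> F\<^sup>\<ge>\<^sup>1\<close>, so \<open>M[-1]\<close> and \<open>H\<^sup>-\<^sup>1 M\<close> lie in
  \<open>F\<^sup>\<ge>\<^sup>1\<close> together.\<close>

lemma tilt_of_intermediate:
  assumes E: "t_structure C E" and F: "t_structure C F"
    and lower: "coaisle E \<subseteq> coaisle F" and upper: "coaisle F \<subseteq> t_ge C E (-1)"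
  defines "\<X> \<equiv> aisle F \<inter> coaisle E" and "\<Y> \<equiv> aisle E \<inter> t_ge C F 1"
  shows "torsion_pair (heart C E) \<X> \<Y>" and "F = tilt C E \<X> \<Y>"
proof -
  have gEF: "t_ge C E n \<subseteq> t_ge C F n" for n
    using t_ge_subset_shift[OF E F, of 0 0 n] lower by (simp add: t_ge_0)
  have gFE: "t_ge C F n \<subseteq> t_ge C E (n - 1)" for n
    using t_ge_subset_shift[OF F E, of 0 "-1" n] upper by (simp add: t_ge_0)
  have lFE: "t_le C F n \<subseteq> t_le C E n" for n
    using t_le_subset_iff_t_ge[OF F E] gEF by blast
  have lEF: "t_le C E n \<subseteq> t_le C F (n + 1)" for n
    using t_le_subset_iff_t_ge[OF E F, of n "n + 1"] gFE[of "n + 1"] by simp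
  have X: "\<X> = t_le C F 0 \<inter> t_ge C E 0" and Y: "\<Y> = t_le C E 0 \<inter> t_ge C F 1"
    by (simp_all add: \<X>_def \<Y>_def t_le_0 t_ge_0)
  let ?H = "t_le C E 0 \<inter> t_ge C E 0"
  have subX: "\<X> \<subseteq> ?H" using lFE X by blast
  have subY: "\<Y> \<subseteq> ?H" using gFE[of 1] Y by auto
  have heart: "heart C E = full_subcat C ?H" by (simp add: heart_def t_le_0 t_ge_0)
  show "torsion_pair (heart C E) \<X> \<Y>"
    unfolding torsion_pair_def
  proof (intro conjI ballI)
    show "full_subcategory (heart C E) \<X>"
      unfolding heart
      by (rule full_subcategory_of_full_subcat[OF additive_class_heart[OF E] _ subX])
        (unfold X, rule additive_class_Int[OF additive_class_t_le[OF F] additive_class_t_ge[OF E]])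
    show "full_subcategory (heart C E) \<Y>"
      unfolding heart
      by (rule full_subcategory_of_full_subcat[OF additive_class_heart[OF E] _ subY])
        (unfold Y, rule additive_class_Int[OF additive_class_t_le[OF E] additive_class_t_ge[OF F]])
  next
    fix M N assume M: "M \<in> \<X>" and N: "N \<in> \<Y>"
    then have "orthogonal M N" using orthogonal_le_ge[OF F, of M 0 N 1] unfolding X Y by simp
    moreover have "M \<in> ?H" "N \<in> ?H" using M N subX subY by blast+
    ultimately show "Hom (heart C E) M N = {Zro (heart C E) M N}"
      unfolding heart orthogonal_def by (simp add: Hom_full_subcat full_subcat_preadditive_simps)
  next
    fix M assume M: "M \<in> Obj (heart C E)"
    then have M0: "M \<in> t_le C E 0" "M \<in> t_ge C E 0" by (simp_all add: Obj_heart)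
    then have MO: "M \<in> Obj C" using t_le_Obj[OF E] by blast
    obtain A B where A: "A \<in> t_le C F 0" and B: "B \<in> t_ge C F 1" and ex: "exact_objects A M B"
      using truncation_exists[OF F MO, of 0] by (auto simp: truncation_triangle_iff)
    have "B \<in> t_ge C E 0" using B gFE[of 1] by auto
    moreover have "t_ge C E 0 \<subseteq> t_ge C E (0 - 1)" using t_ge_mono[OF E] by simp
    ultimately have AE: "A \<in> t_ge C E 0" using t_ge_cocone[OF E ex M0(2)] by blast
    have "A \<in> t_le C E (0 + 1)" using A lFE t_le_mono[OF E, of 0 1] by auto
    then have BE: "B \<in> t_le C E 0" using t_le_cone[OF E ex _ M0(1)] by blast
    have AX: "A \<in> \<X>" and BY: "B \<in> \<Y>" using A B AE BE X Y by blast+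
    then have AH: "A \<in> Obj (heart C E)" and BH: "B \<in> Obj (heart C E)"
      using subX subY by (auto simp: Obj_heart)
    obtain f g h where e: "exact f g h A M B" using ex unfolding exact_objects_def by blast
    have "f \<in> Hom (heart C E) A M" "g \<in> Hom (heart C E) M B"
      using exactD(1,2)[OF e] AH BH M unfolding heart
      by (simp_all add: Hom_full_subcat full_subcat_simps)
    then show "\<exists>A\<in>\<X>. \<exists>B\<in>\<Y>. \<exists>f\<in>Hom (heart C E) A M. \<exists>g\<in>Hom (heart C E) M B.
        short_exact (heart C E) f g"
      using AX BY short_exact_heart[OF E e AH M BH] by blast
  qed
  \<comment> \<open>Here \<open>A\<close> is isomorphic to \<open>M\<close>, since the other truncation \<open>B\<close> is zero.\<close>
  have aisle_iff: "M \<in> t_le C F 0 \<longleftrightarrow> cohomology C E 0 M \<in> \<X>" if M: "M \<in> t_le C E 0" for M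
  proof -
    have MO: "M \<in> Obj C" using M t_le_Obj[OF E] by blast
    obtain A B A' where "A \<in> t_le C E 0" "B \<in> t_ge C E 1" "exact_objects A (shift C 0 M) B"
      and A': "A' \<in> t_le C E (-1)" and H: "cohomology C E 0 M \<in> t_ge C E 0"
      and ex': "exact_objects A' A (cohomology C E 0 M)"
      using cohomology_triangles[OF E MO] by metis
    then have A: "A \<in> t_le C E 0" and B: "B \<in> t_ge C E 1" and ex: "exact_objects A M B"
      by (simp_all add: shift_0)
    have "A \<in> t_le C E (0 + 1)" using A t_le_mono[OF E, of 0 1] by auto
    then have "B \<in> t_le C E 0" using t_le_cone[OF E ex _ M] by blast
    then have B0: "B \<in> zero_objects C" using zero_if_le_ge[OF E _ B] by fastforce
    have A'F: "A' \<in> t_le C F 0" using A' lEF[of "-1"] by auto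
    have "M \<in> t_le C F 0 \<longleftrightarrow> A \<in> t_le C F 0"
    proof
      assume MF: "M \<in> t_le C F 0"
      have "shift C (-1) B \<in> t_le C F 0"
        using t_le_shift[OF F zero_object_Obj[OF B0]] t_le_zero[OF F B0] by blast
      then show "A \<in> t_le C F 0" using t_le_extension[OF F exact_objects_rotate_back[OF ex] _ MF] by blast
    next
      assume "A \<in> t_le C F 0"
      then show "M \<in> t_le C F 0" using t_le_extension[OF F ex _ t_le_zero[OF F B0]] by blast
    qed
    also have "\<dots> \<longleftrightarrow> cohomology C E 0 M \<in> t_le C F 0"
    proof
      assume AF: "A \<in> t_le C F 0"
      have "A' \<in> t_le C F (0 + 1)" using A'F t_le_mono[OF F, of 0 1] by auto
      then show "cohomology C E 0 M \<in> t_le C F 0" using t_le_cone[OF F ex' _ AF] by blast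
    next
      assume "cohomology C E 0 M \<in> t_le C F 0"
      then show "A \<in> t_le C F 0" using t_le_extension[OF F ex' A'F] by blast
    qed
    finally show ?thesis using H X by blast
  qed
  have coaisle_iff: "M \<in> t_ge C F 0 \<longleftrightarrow> cohomology C E (-1) M \<in> \<Y>" if M: "M \<in> t_ge C E (-1)" for M
  proof -
    have MO: "M \<in> Obj C" using M t_ge_Obj[OF E] by blast
    let ?M = "shift C (-1) M"
    obtain A B A' where A: "A \<in> t_le C E 0" and B: "B \<in> t_ge C E 1" and ex: "exact_objects A ?M B"
      and A': "A' \<in> t_le C E (-1)" and H: "cohomology C E (-1) M \<in> t_ge C E 0"
      and ex': "exact_objects A' A (cohomology C E (-1) M)"
      using cohomology_triangles[OF E MO] by metis
    have M0: "?M \<in> t_ge C E 0" using M t_ge_shift[OF E MO, of "-1" 0] by simp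
    have "B \<in> t_ge C E (0 - 1)" using B t_ge_mono[OF E, of "0 - 1" 1] by auto
    then have A0: "A \<in> t_ge C E 0" using t_ge_cocone[OF E ex M0] by blast
    have H0: "cohomology C E (-1) M \<in> t_le C E 0"
      using t_le_cone[OF E ex' _ A] A' t_le_mono[OF E, of "-1" "0 + 1"] by auto
    \<comment> \<open>\<open>A\<close> already lies in the heart, so its further truncation changes nothing.\<close>
    have "A' \<in> t_ge C E 0"
      using t_ge_cocone[OF E ex' A0] H t_ge_mono[OF E, of "0 - 1" 0] by auto
    then have A'0: "A' \<in> zero_objects C" using zero_if_le_ge[OF E A'] by fastforce
    have BF: "B \<in> t_ge C F 1" using B gEF by blast
    have "M \<in> t_ge C F 0 \<longleftrightarrow> ?M \<in> t_ge C F 1" using t_ge_shift[OF F MO, of "-1" 1] by simp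
    also have "\<dots> \<longleftrightarrow> A \<in> t_ge C F 1"
    proof
      assume "?M \<in> t_ge C F 1"
      then show "A \<in> t_ge C F 1" using t_ge_cocone[OF F ex] BF t_ge_mono[OF F, of "1 - 1" 1] by auto
    next
      assume "A \<in> t_ge C F 1"
      then show "?M \<in> t_ge C F 1" using t_ge_extension[OF F ex _ BF] by blast
    qed
    also have "\<dots> \<longleftrightarrow> cohomology C E (-1) M \<in> t_ge C F 1"
    proof
      assume AF: "A \<in> t_ge C F 1"
      have O: "A' \<in> Obj C" using zero_object_Obj[OF A'0] .
      have "ShO C A' \<in> t_ge C F 1"
        using t_ge_shift[OF F O, of 1] t_ge_zero[OF F A'0] shift_1[OF O] by simp
      then show "cohomology C E (-1) M \<in> t_ge C F 1"
        using t_ge_extension[OF F exact_objects_rotate[OF ex'] AF] by blast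
    next
      assume "cohomology C E (-1) M \<in> t_ge C F 1"
      then show "A \<in> t_ge C F 1" using t_ge_extension[OF F ex' t_ge_zero[OF F A'0]] by blast
    qed
    finally show ?thesis using H0 Y by blast
  qed
  show "F = tilt C E \<X> \<Y>"
  proof (rule prod_eqI)
    show "aisle F = aisle (tilt C E \<X> \<Y>)"
    proof (intro subset_antisym subsetI)
      fix M assume "M \<in> aisle F"
      then have MF: "M \<in> t_le C F 0" by (simp add: t_le_0)
      then have ME: "M \<in> t_le C E 0" using lFE by blast
      then show "M \<in> aisle (tilt C E \<X> \<Y>)"
        using MF aisle_iff[OF ME] cohomology_zero_if_t_le[OF E ME] t_le_Obj[OF E]
        unfolding tilt_def by auto
    next
      fix M assume M: "M \<in> aisle (tilt C E \<X> \<Y>)"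
      then have ME: "M \<in> t_le C E 0"
        using t_le_if_cohomology_zero[OF E, of M 0] by (simp add: tilt_def)
      have "cohomology C E 0 M \<in> \<X>" using M by (simp add: tilt_def)
      then have "M \<in> t_le C F 0" using aisle_iff[OF ME] by blast
      then show "M \<in> aisle F" by (simp add: t_le_0)
    qed
    show "coaisle F = coaisle (tilt C E \<X> \<Y>)"
    proof (intro subset_antisym subsetI)
      fix M assume "M \<in> coaisle F"
      then have MF: "M \<in> t_ge C F 0" by (simp add: t_ge_0)
      then have ME: "M \<in> t_ge C E (-1)" using gFE[of 0] by auto
      then show "M \<in> coaisle (tilt C E \<X> \<Y>)"
        using MF coaisle_iff[OF ME] cohomology_zero_if_t_ge[OF E ME] t_ge_Obj[OF E]
        unfolding tilt_def by auto
    next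
      fix M assume M: "M \<in> coaisle (tilt C E \<X> \<Y>)"
      then have ME: "M \<in> t_ge C E (-1)"
        using t_ge_if_cohomology_zero[OF E, of M "-1"] by (simp add: tilt_def)
      have "cohomology C E (-1) M \<in> \<Y>" using M by (simp add: tilt_def)
      then have "M \<in> t_ge C F 0" using coaisle_iff[OF ME] by blast
      then show "M \<in> coaisle F" by (simp add: t_ge_0)
    qed
  qed
qed

section \<open>Iterated tilting\<close>

lemma iterated_HRS_bounds:
  assumes "iterated_HRS C m D T"
  shows "t_le C D (- int m) \<subseteq> t_le C T 0" "t_le C T 0 \<subseteq> t_le C D 0"
proof -
  obtain E where E0: "E 0 = D" and Em: "E m = T" and t: "\<And>i. i \<le> m \<Longrightarrow> t_structure C (E i)"
    and step: "\<And>i. i < m \<Longrightarrow> \<exists>\<X> \<Y>. torsion_pair (heart C (E i)) \<X> \<Y> \<and> E (Suc i) = tilt C (E i) \<X> \<Y>"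
    using assms unfolding iterated_HRS_def by blast
  have "t_le C D (- int i) \<subseteq> t_le C (E i) 0 \<and> t_le C (E i) 0 \<subseteq> t_le C D 0" if "i \<le> m" for i
    using that
  proof (induction i)
    case 0
    then show ?case by (simp add: E0)
  next
    case (Suc i)
    then have i: "i < m" "i \<le> m" by simp_all
    obtain \<X> \<Y> where XY: "torsion_pair (heart C (E i)) \<X> \<Y>" "E (Suc i) = tilt C (E i) \<X> \<Y>"
      using step i(1) by blast
    note b = tilt_bounds[OF t[OF i(2)] XY(1), folded XY(2) t_le_0]
    have "t_structure C D" using t[of 0] E0 by simp
    then have "t_le C D (- int i + -1) \<subseteq> t_le C (E i) (0 + -1)"
      using t_le_subset_shift[OF _ t[OF i(2)]] Suc.IH[OF i(2)] by blast
    moreover have "- int i + -1 = - int (Suc i)" "0 + -1 = (-1::int)" by simp_all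
    ultimately have "t_le C D (- int (Suc i)) \<subseteq> t_le C (E i) (-1)" by metis
    then show ?case using b Suc.IH[OF i(2)] by blast
  qed
  from this[of m] show "t_le C D (- int m) \<subseteq> t_le C T 0" "t_le C T 0 \<subseteq> t_le C D 0"
    using Em by simp_all
qed

text \<open>The co-aisles \<open>D\<^sup>\<ge>\<^sup>-\<^sup>i \<inter> T\<^sup>\<ge>\<^sup>0\<close> grow with \<open>i\<close> from \<open>D\<^sup>\<ge>\<^sup>0\<close> to \<open>T\<^sup>\<ge>\<^sup>0\<close>, and each of them contains the
  next one shifted by \<open>[-1]\<close>, because shifting by \<open>[-1]\<close> leaves \<open>T\<^sup>\<ge>\<^sup>0\<close> stable and carries
  \<open>D\<^sup>\<ge>\<^sup>-\<^sup>i\<^sup>-\<^sup>1\<close> to \<open>D\<^sup>\<ge>\<^sup>-\<^sup>i\<close>.\<close>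

lemma iterated_HRS_if_bounds:
  assumes D: "t_structure C D" and T: "t_structure C T" and filt: "right_filterable C D T"
    and lower: "t_ge C D 0 \<subseteq> t_ge C T 0" and upper: "t_ge C T 0 \<subseteq> t_ge C D (- int m)"
  shows "iterated_HRS C m D T"
proof -
  define E where "E i = (SOME S. t_structure C S \<and> coaisle S = t_ge C D (- int i) \<inter> t_ge C T 0)" for i
  have "t_structure C (E i) \<and> coaisle (E i) = t_ge C D (- int i) \<inter> t_ge C T 0" for i
    unfolding E_def by (rule someI_ex) (use filt in \<open>simp add: right_filterable_def\<close>)
  then have t: "t_structure C (E i)" and co: "coaisle (E i) = t_ge C D (- int i) \<inter> t_ge C T 0" for i
    by simp_all
  have "coaisle (E 0) = coaisle D" using co[of 0] lower by (auto simp: t_ge_0)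
  then have E0: "E 0 = D" using coaisle_determines_t_structure t D by blast
  have "coaisle (E m) = coaisle T" using co[of m] upper by (auto simp: t_ge_0)
  then have Em: "E m = T" using coaisle_determines_t_structure t T by blast
  have "\<exists>\<X> \<Y>. torsion_pair (heart C (E i)) \<X> \<Y> \<and> E (Suc i) = tilt C (E i) \<X> \<Y>" for i
  proof -
    have "coaisle (E i) \<subseteq> coaisle (E (Suc i))"
      unfolding co using t_ge_mono[OF D, of "- int (Suc i)" "- int i"] by auto
    moreover have "coaisle (E (Suc i)) \<subseteq> t_ge C (E i) (-1)"
    proof
      fix M assume "M \<in> coaisle (E (Suc i))"
      then have M: "M \<in> t_ge C D (- int (Suc i))" "M \<in> t_ge C T 0" by (simp_all add: co)
      then have MO: "M \<in> Obj C" using t_ge_Obj[OF D] by blast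
      have "M \<in> t_ge C T (-1)" using M(2) t_ge_mono[OF T, of "-1" 0] by auto
      then have "shift C (-1) M \<in> t_ge C D (- int i) \<inter> t_ge C T 0"
        using M(1) t_ge_shift[OF D MO] t_ge_shift[OF T MO] by (simp add: algebra_simps)
      then show "M \<in> t_ge C (E i) (-1)" using t_ge_iff[OF t] co MO by simp
    qed
    ultimately show ?thesis using tilt_of_intermediate[OF t t] by blast
  qed
  then show ?thesis unfolding iterated_HRS_def using t E0 Em by blast
qed

end

theorem corollary2p14:
  fixes C :: "('o, 'a) triangulated_data"
    and D T :: "'o t_pair"
    and m :: nat
  assumes "triangulated_category C"
    and "t_structure C D"
    and "t_structure C T"
    and "right_filterable C D T"
  shows "(t_le C D (- int m) \<subseteq> t_le C T 0 \<and> t_le C T 0 \<subseteq> t_le C D 0 \<longleftrightarrow> iterated_HRS C m D T) \<and>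
         (t_le C D (- int m) \<subseteq> t_le C T 0 \<and> t_le C T 0 \<subseteq> t_le C D 0 \<longleftrightarrow>
          t_ge C D 0 \<subseteq> t_ge C T 0 \<and> t_ge C T 0 \<subseteq> t_ge C D (- int m))"
proof -
  interpret triangulated_category C by fact
  have ge: "t_le C D (- int m) \<subseteq> t_le C T 0 \<and> t_le C T 0 \<subseteq> t_le C D 0 \<longleftrightarrow>
      t_ge C D 0 \<subseteq> t_ge C T 0 \<and> t_ge C T 0 \<subseteq> t_ge C D (- int m)"
    using t_le_subset_iff_t_ge[OF assms(2,3), of "- int m" 0]
      t_le_subset_iff_t_ge[OF assms(3,2), of 0 0] by blast
  show ?thesis
    using ge iterated_HRS_bounds[of m D T] iterated_HRS_if_bounds[OF assms(2-4), of m] by blast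
qed

end
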